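(* Let $Q$ be an infinite $\mathbb{N}^*\setminus Q$--free set with $Q\subsetneq\mathbb{N}^*$, and let $n\ge 1$ be an integer and $\tau>1$ a real number. \begin{itemize} \item If $\nu(Q)<1$ and $\tau>1+1/n$, then $\dim W^*_{\tau,n}(Q)=(n+1)/\tau$. \item If $\nu(Q)=1$, $n\ge 2$ and $\tau>1+1/(n-1)$, then $n/\tau\le \dim W^*_{\tau,n}(Q)\le (n+1)/\tau$. \end{itemize}
   Context: $\mathbb{N}^*$ denotes the set of positive integers and $\dim$ denotes Hausdorff dimension. A set $Q\subseteq\mathbb{N}^*$ is called $\mathbb{N}^*\setminus Q$--free if for every $q\in\mathbb{N}^*$: $q\in Q$ if and only if no $v\in\mathbb{N}^*\setminus Q$ divides $q$. For an infinite set $Q\subseteq\mathbb{N}^*$, its exponent of convergence is $\nu(Q)=\inf\{\nu>0:\sum_{q\in Q}q^{-\nu}<\infty\}\in[0,1]$. For an integer $n\ge1$ and a real number $\tau>1$, $W_{\tau,n}$ is the set of $(x_1,\dots,x_n)\in\mathbb{R}^n$ for which there are infinitely many integers $q\ge1$ such that, for some integers $p_1,\dots,p_n$, $|x_i-p_i/q|<q^{-\tau}$ holds for all $i\in\{1,\dots,n\}$. For $Q\subseteq\mathbb{N}^*$, $W_{\tau,n}(Q)$ is defined in the same way, except that the infinitely many $q$ are required to lie in $Q$. Finally, $W^*_{\tau,n}(Q)=W_{\tau,n}\setminus W_{\tau,n}(Q)$. *)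

theory Defs
  imports "HOL-Analysis.Analysis"
begin

definition hausdorff_content :: "real \<Rightarrow> real \<Rightarrow> 'a::metric_space set \<Rightarrow> ennreal" where
  "hausdorff_content s \<delta> A =
     (INF U \<in> {U :: nat \<Rightarrow> 'a set. A \<subseteq> (\<Union>i. U i) \<and> (\<forall>i. bounded (U i) \<and> diameter (U i) \<le> \<delta>)}.
        (\<Sum>i. ennreal (diameter (U i) powr s)))"

definition hausdorff_measure :: "real \<Rightarrow> 'a::metric_space set \<Rightarrow> ennreal" where
  "hausdorff_measure s A = (SUP \<delta> \<in> {0<..}. hausdorff_content s \<delta> A)"

(* dim A = inf { s > 0 : H^s(A) = 0 }  (equals the usual inf over s >= 0) *)
definition hausdorff_dim :: "'a::metric_space set \<Rightarrow> real" where
  "hausdorff_dim A = Inf {s. 0 < s \<and> hausdorff_measure s A = 0}"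

definition nfree :: "nat set \<Rightarrow> bool" where
  "nfree Q \<longleftrightarrow> (\<forall>q\<ge>1. q \<in> Q \<longleftrightarrow> \<not> (\<exists>v\<ge>1. v \<notin> Q \<and> v dvd q))"

definition conv_exponent :: "nat set \<Rightarrow> real" where
  "conv_exponent Q = Inf {\<nu>. 0 < \<nu> \<and> (\<lambda>q. real q powr (-\<nu>)) summable_on Q}"

definition W_set :: "real \<Rightarrow> nat set \<Rightarrow> (real ^ 'n) set" where
  "W_set \<tau> Q = {x. infinite {q \<in> Q. q \<ge> 1 \<and>
      (\<exists>p :: 'n \<Rightarrow> int. \<forall>i. \<bar>x $ i - real_of_int (p i) / real q\<bar> < real q powr (-\<tau>))}}"

definition W_star :: "real \<Rightarrow> nat set \<Rightarrow> (real ^ 'n) set" where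
  "W_star \<tau> Q = W_set \<tau> {q. q \<ge> 1} - W_set \<tau> Q"

end

theory Submission
  imports Defs
begin

text \<open>
  The upper bound is the obvious covering by the boxes around rational points. For the lower bound,
  let \<open>I\<close> be a set of \<open>m\<close> coordinates, freeze the others, and let \<open>U\<^sub>k\<close> be a cover with small
  \<open>\<Sum>\<^sub>k (diam U\<^sub>k)\<^sup>s\<close>, where \<open>s < (m + 1) / \<tau>\<close>. One builds nested boxes of radius \<open>\<rho> \<approx> N powr -\<tau>\<close> around
  rational points with denominators of order \<open>N\<close> such that the members of the cover meeting such a box
  have total \<open>s\<close>-cost at most \<open>\<gamma> \<rho>\<^sup>s\<close>; the limit point then lies in no \<open>U\<^sub>k\<close>.
  The next box exists by volume comparison: by Dirichlet's theorem the current box is covered by boxes of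
  radius \<open>\<approx> \<delta> = N powr -(1 + 1/m)\<close> around rational points, apart from a small part approximated only with
  small denominators. Members of the cover larger than \<open>\<delta>\<close> spoil only a small proportion of the volume, and each
  smaller member meets at most one box of a \<open>4\<delta>\<close>-separated family, so that it cannot spoil
  all of the roughly \<open>N ^ (m + 1)\<close> candidates.

  If \<open>\<nu>(Q) < 1\<close>, then \<open>W_set \<tau> Q\<close> has smaller dimension than \<open>W_set \<tau> {q. q \<ge> 1}\<close> and may be discarded.
  If \<open>\<nu>(Q) = 1\<close>, freeze one coordinate at \<open>1 / v\<close> with \<open>v \<notin> Q\<close>.
\<close>

section \<open>Hausdorff null sets\<close>

lemma ennreal_le_suminf:
  fixes f :: "nat \<Rightarrow> ennreal"
  shows "f i \<le> (\<Sum>i. f i)"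
  using sum_le_suminf[of f "{i}"] by simp

text \<open>The mesh condition comes for free: in a cover of cost at most
  \<open>\<delta> powr s\<close> every member has diameter at most \<open>\<delta>\<close>. Nullity
  can thus be tested with covers of arbitrary mesh.\<close>

lemma hausdorff_null_iff:
  fixes A :: "'a::metric_space set"
  assumes s: "s > 0"
  shows "hausdorff_measure s A = 0 \<longleftrightarrow>
    (\<forall>e>0. \<exists>U :: nat \<Rightarrow> 'a set. A \<subseteq> (\<Union>i. U i) \<and> (\<forall>i. bounded (U i)) \<and>
       (\<Sum>i. ennreal (diameter (U i) powr s)) \<le> ennreal e)" (is "_ \<longleftrightarrow> ?R")
proof
  assume 0: "hausdorff_measure s A = 0"
  have "hausdorff_content s 1 A \<le> hausdorff_measure s A"
    unfolding hausdorff_measure_def by (rule SUP_upper) simp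
  then have c0: "hausdorff_content s 1 A = 0"
    using 0 by simp
  show ?R
  proof (intro allI impI)
    fix e :: real assume "e > 0"
    then have "hausdorff_content s 1 A < ennreal e"
      using c0 by simp
    then show "\<exists>U :: nat \<Rightarrow> 'a set. A \<subseteq> (\<Union>i. U i) \<and> (\<forall>i. bounded (U i)) \<and>
       (\<Sum>i. ennreal (diameter (U i) powr s)) \<le> ennreal e"
      unfolding hausdorff_content_def INF_less_iff by (auto intro: less_imp_le)
  qed
next
  assume R: ?R
  have "hausdorff_content s \<delta> A \<le> ennreal e" if "\<delta> > 0" "e > 0" for \<delta> e
  proof -
    define e' where "e' = min e (\<delta> powr s)"
    have "e' > 0" using that by (simp add: e'_def)
    with R obtain U :: "nat \<Rightarrow> 'a set" where U: "A \<subseteq> (\<Union>i. U i)" "\<And>i. bounded (U i)"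
       "(\<Sum>i. ennreal (diameter (U i) powr s)) \<le> ennreal e'"
      by blast
    have "diameter (U i) \<le> \<delta>" for i
    proof -
      have "ennreal (diameter (U i) powr s) \<le> (\<Sum>i. ennreal (diameter (U i) powr s))"
        by (rule ennreal_le_suminf)
      also have "\<dots> \<le> ennreal (\<delta> powr s)"
        using U(3) by (rule order_trans) (simp add: e'_def ennreal_leI)
      finally have "diameter (U i) powr s \<le> \<delta> powr s"
        by (simp add: ennreal_le_iff)
      then show ?thesis
        using powr_less_mono2[OF s, of \<delta> "diameter (U i)"] that by fastforce
    qed
    then have "hausdorff_content s \<delta> A \<le> (\<Sum>i. ennreal (diameter (U i) powr s))"
      unfolding hausdorff_content_def using U by (intro INF_lower) auto
    also have "\<dots> \<le> ennreal e"
      using U(3) by (rule order_trans) (simp add: e'_def ennreal_leI)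
    finally show ?thesis .
  qed
  then have "hausdorff_content s \<delta> A = 0" if "\<delta> > 0" for \<delta>
    using that ennreal_le_epsilon[of 0 "hausdorff_content s \<delta> A"] by simp
  then show "hausdorff_measure s A = 0"
    unfolding hausdorff_measure_def by (simp add: SUP_eq_iff)
qed

lemma hausdorff_null_subset:
  assumes "s > 0" "hausdorff_measure s B = 0" "A \<subseteq> B"
  shows "hausdorff_measure s A = 0"
  using assms unfolding hausdorff_null_iff[OF assms(1)] by (meson order_trans)

text \<open>In a cover of cost at most 1 all diameters are at most 1, and then a larger exponent
  does not increase the cost.\<close>

lemma hausdorff_null_mono_exponent:
  fixes A :: "'a::metric_space set"
  assumes s: "s > 0" "s \<le> t" and A: "hausdorff_measure s A = 0"
  shows "hausdorff_measure t A = 0"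
proof -
  have t: "t > 0" using s by simp
  show ?thesis
    unfolding hausdorff_null_iff[OF t]
  proof (intro allI impI)
    fix e :: real assume "e > 0"
    then have "min e 1 > 0" by simp
    with A obtain U :: "nat \<Rightarrow> 'a set" where U: "A \<subseteq> (\<Union>i. U i)" "\<And>i. bounded (U i)"
       "(\<Sum>i. ennreal (diameter (U i) powr s)) \<le> ennreal (min e 1)"
      unfolding hausdorff_null_iff[OF s(1)] by blast
    have "ennreal (diameter (U i) powr t) \<le> ennreal (diameter (U i) powr s)" for i
    proof -
      have "ennreal (diameter (U i) powr s) \<le> (\<Sum>i. ennreal (diameter (U i) powr s))"
        by (rule ennreal_le_suminf)
      also have "\<dots> \<le> ennreal 1"
        using U(3) by (rule order_trans) (simp add: ennreal_leI)
      finally have "diameter (U i) powr s \<le> 1"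
        using ennreal_le_iff[of 1 "diameter (U i) powr s"] by (simp del: ennreal_1)
      then have "diameter (U i) \<le> 1"
        using powr_less_mono2[OF s(1), of 1 "diameter (U i)"] by fastforce
      then show ?thesis
        using s diameter_ge_0[OF U(2)[of i]] by (intro ennreal_leI powr_mono') auto
    qed
    then have "(\<Sum>i. ennreal (diameter (U i) powr t)) \<le> (\<Sum>i. ennreal (diameter (U i) powr s))"
      by (intro suminf_le) auto
    also have "\<dots> \<le> ennreal e"
      using U(3) by (rule order_trans) (simp add: ennreal_leI)
    finally show "\<exists>U :: nat \<Rightarrow> 'a set. A \<subseteq> (\<Union>i. U i) \<and> (\<forall>i. bounded (U i)) \<and>
       (\<Sum>i. ennreal (diameter (U i) powr t)) \<le> ennreal e"
      using U by blast
  qed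
qed

lemma cover_of_double_cover:
  fixes V :: "nat \<Rightarrow> nat \<Rightarrow> 'a::metric_space set"
  assumes "A \<subseteq> (\<Union>i j. V i j)" "\<And>i j. bounded (V i j)"
    "(\<Sum>i j. ennreal (diameter (V i j) powr s)) \<le> ennreal e"
  shows "\<exists>U :: nat \<Rightarrow> 'a set. A \<subseteq> (\<Union>i. U i) \<and> (\<forall>i. bounded (U i)) \<and>
       (\<Sum>i. ennreal (diameter (U i) powr s)) \<le> ennreal e"
proof -
  define f where "f = (\<lambda>(i, j). V i j)"
  have "(\<Sum>k. ennreal (diameter (f (prod_decode k)) powr s)) = (\<Sum>i j. ennreal (diameter (V i j) powr s))"
    by (rule suminf_ennreal_2dimen) (simp add: f_def)
  moreover have "A \<subseteq> (\<Union>k. f (prod_decode k))"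
  proof
    fix x assume "x \<in> A"
    then obtain i j where "x \<in> V i j" using assms(1) by blast
    then have "x \<in> f (prod_decode (prod_encode (i, j)))" by (simp add: f_def)
    then show "x \<in> (\<Union>k. f (prod_decode k))" by blast
  qed
  moreover have "\<forall>k. bounded (f (prod_decode k))"
    using assms(2) by (simp add: f_def split: prod.split)
  ultimately show ?thesis
    using assms(3) by (intro exI[of _ "\<lambda>k. f (prod_decode k)"]) simp
qed

lemma hausdorff_null_UN:
  fixes A :: "nat \<Rightarrow> 'a::metric_space set"
  assumes s: "s > 0" and A: "\<And>i. hausdorff_measure s (A i) = 0"
  shows "hausdorff_measure s (\<Union>i. A i) = 0"
  unfolding hausdorff_null_iff[OF s]
proof (intro allI impI)
  fix e :: real assume e: "e > 0"
  have "\<exists>V :: nat \<Rightarrow> 'a set. A i \<subseteq> (\<Union>j. V j) \<and> (\<forall>j. bounded (V j)) \<and>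
       (\<Sum>j. ennreal (diameter (V j) powr s)) \<le> ennreal (e * (1/2) ^ Suc i)" for i
    using A[of i, unfolded hausdorff_null_iff[OF s]] e by simp
  then obtain V :: "nat \<Rightarrow> nat \<Rightarrow> 'a set" where V: "\<And>i. A i \<subseteq> (\<Union>j. V i j)" "\<And>i j. bounded (V i j)"
     "\<And>i. (\<Sum>j. ennreal (diameter (V i j) powr s)) \<le> ennreal (e * (1/2) ^ Suc i)"
    by metis
  have "(\<Sum>i j. ennreal (diameter (V i j) powr s)) \<le> (\<Sum>i. ennreal (e * (1/2) ^ Suc i))"
    by (intro suminf_le V) auto
  also have "\<dots> = ennreal e"
  proof (rule suminf_ennreal_eq)
    show "(\<lambda>i. e * (1 / 2) ^ Suc i) sums e"
      using sums_mult[OF power_half_series, of e] by simp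
  qed (use e in auto)
  finally have V3: "(\<Sum>i j. ennreal (diameter (V i j) powr s)) \<le> ennreal e" .
  have "(\<Union>i. A i) \<subseteq> (\<Union>i j. V i j)"
    by (rule UN_mono[OF order.refl V(1)])
  then show "\<exists>U :: nat \<Rightarrow> 'a set. (\<Union>i. A i) \<subseteq> (\<Union>i. U i) \<and> (\<forall>i. bounded (U i)) \<and>
       (\<Sum>i. ennreal (diameter (U i) powr s)) \<le> ennreal e"
    using V(2) V3 by (rule cover_of_double_cover)
qed

lemma hausdorff_null_Un:
  fixes A B :: "'a::metric_space set"
  assumes "s > 0" "hausdorff_measure s A = 0" "hausdorff_measure s B = 0"
  shows "hausdorff_measure s (A \<union> B) = 0"
proof -
  have "hausdorff_measure s (\<Union>i::nat. if i = 0 then A else B) = 0"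
    by (rule hausdorff_null_UN) (use assms in auto)
  moreover have "(\<Union>i::nat. if i = 0 then A else B) = A \<union> B"
    by (auto split: if_splits)
  ultimately show ?thesis by simp
qed

section \<open>Convergent series and limsup sets\<close>

text \<open>The easy half of Borel-Cantelli: every tail of the families covers the limsup set, at
  the cost of a tail of a convergent series.\<close>

lemma hausdorff_null_limsup:
  fixes F :: "nat \<Rightarrow> 'a::metric_space set set"
  assumes s: "s > 0"
    and F: "\<And>q. finite (F q)" "\<And>q B. B \<in> F q \<Longrightarrow> bounded B \<and> diameter B \<le> D q"
    and sm: "summable (\<lambda>q. real (card (F q)) * D q powr s)"
  shows "hausdorff_measure s {x. infinite {q. x \<in> \<Union>(F q)}} = 0"
  unfolding hausdorff_null_iff[OF s]
proof (intro allI impI)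
  fix e :: real assume e: "e > 0"
  define g where "g q = real (card (F q)) * D q powr s" for q
  have g0: "g q \<ge> 0" for q by (simp add: g_def)
  obtain q0 where q0: "norm (\<Sum>i. g (i + q0)) < e"
    using suminf_exist_split[OF e sm] unfolding g_def by blast
  have "\<exists>h. bij_betw h {0..<card (F q)} (F q)" for q
    by (rule ex_bij_betw_nat_finite[OF F(1)])
  then obtain h where h: "\<And>q. bij_betw (h q) {0..<card (F q)} (F q)" by metis
  \<comment> \<open>The families from index \<open>q0\<close> on, padded by empty sets, which have
    diameter and hence cost 0.\<close>
  define V where "V i j = (if j < card (F (i + q0)) then h (i + q0) j else {})" for i j
  have hF: "h q j \<in> F q" if "j < card (F q)" for q j
    using h[of q] that by (auto simp: bij_betw_def)
  show "\<exists>U :: nat \<Rightarrow> 'a set. {x. infinite {q. x \<in> \<Union>(F q)}} \<subseteq> (\<Union>i. U i) \<and> (\<forall>i. bounded (U i)) \<and>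
       (\<Sum>i. ennreal (diameter (U i) powr s)) \<le> ennreal e"
  proof (rule cover_of_double_cover[of _ V])
    show "{x. infinite {q. x \<in> \<Union>(F q)}} \<subseteq> (\<Union>i j. V i j)"
    proof
      fix x assume "x \<in> {x. infinite {q. x \<in> \<Union>(F q)}}"
      then have "infinite {q. x \<in> \<Union>(F q)}"
        by (rule CollectD)
      then obtain q where "q0 < q" and q: "q \<in> {q. x \<in> \<Union>(F q)}"
        unfolding infinite_nat_iff_unbounded by metis
      from q obtain B where B: "B \<in> F q" "x \<in> B" by auto
      then have "B \<in> h q ` {0..<card (F q)}"
        using h[of q] by (simp add: bij_betw_def)
      then obtain j where "j < card (F q)" "h q j = B"
        by auto
      then have "x \<in> V (q - q0) j" using B \<open>q0 < q\<close> by (simp add: V_def)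
      then show "x \<in> (\<Union>i j. V i j)" by blast
    qed
    show "bounded (V i j)" for i j
      using F(2)[OF hF] by (simp add: V_def)
    have "(\<Sum>j. ennreal (diameter (V i j) powr s)) \<le> ennreal (g (i + q0))" for i
    proof -
      have "(\<Sum>j. ennreal (diameter (V i j) powr s)) =
          (\<Sum>j<card (F (i + q0)). ennreal (diameter (V i j) powr s))"
        by (intro suminf_finite) (auto simp: V_def)
      also have "\<dots> \<le> (\<Sum>j<card (F (i + q0)). ennreal (D (i + q0) powr s))"
        using F(2)[OF hF] s
        by (intro sum_mono ennreal_leI powr_mono2) (auto simp: V_def diameter_ge_0)
      also have "\<dots> = ennreal (g (i + q0))"
        by (simp add: g_def ennreal_mult ennreal_of_nat_eq_real_of_nat)
      finally show ?thesis .
    qed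
    then have "(\<Sum>i j. ennreal (diameter (V i j) powr s)) \<le> (\<Sum>i. ennreal (g (i + q0)))"
      by (intro suminf_le) auto
    also have "\<dots> = ennreal (\<Sum>i. g (i + q0))"
      using sm g0 summable_ignore_initial_segment[of g q0] unfolding g_def
      by (intro suminf_ennreal2) auto
    also have "\<dots> \<le> ennreal e"
      using q0 by (intro ennreal_leI) auto
    finally show "(\<Sum>i j. ennreal (diameter (V i j) powr s)) \<le> ennreal e" .
  qed
qed

text \<open>With \<open>n = CARD('n)\<close>, inside a cube the denominator \<open>q\<close>
  contributes \<open>O(q ^ n)\<close> boxes of diameter \<open>O(q powr -\<tau>)\<close>, hence cost
  \<open>O(q powr (n - \<tau> * s))\<close>. Countably many cubes exhaust the space.\<close>

lemma hausdorff_null_W_set: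
  assumes s: "s > 0"
    and sm: "summable (\<lambda>q. if q \<in> Q then real q powr (real CARD('n) - \<tau> * s) else 0)"
    and tau: "\<tau> > 0"
  shows "hausdorff_measure s (W_set \<tau> Q :: (real ^ 'n) set) = 0"
proof -
  let ?W = "W_set \<tau> Q :: (real ^ 'n) set"
  have null: "hausdorff_measure s (?W \<inter> {x. \<forall>i. \<bar>x $ i\<bar> \<le> real R}) = 0" for R :: nat
  proof -
    define B :: "nat \<Rightarrow> ('n \<Rightarrow> int) \<Rightarrow> (real ^ 'n) set" where
      "B q p = {x. \<forall>i. \<bar>x $ i - real_of_int (p i) / real q\<bar> < real q powr (-\<tau>)}" for q p
    \<comment> \<open>For a point with coordinates bounded by \<open>R\<close> the approximation
      error is at most 1, so its numerators satisfy
      \<open>\<bar>p i\<bar> \<le> (R + 1) * q\<close>.\<close>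
    define K :: "nat \<Rightarrow> ('n \<Rightarrow> int) set" where
      "K q = PiE UNIV (\<lambda>_. {- int ((R + 1) * q) .. int ((R + 1) * q)})" for q
    define F where "F q = (if q \<in> Q \<and> q \<ge> 1 then B q ` K q else {})" for q
    \<comment> \<open>The Euclidean norm is at most the sum of the absolute coordinates, each below
      twice the radius.\<close>
    define D where "D q = real CARD('n) * (2 * real q powr (-\<tau>))" for q
    have finK: "finite (K q)" for q unfolding K_def by (intro finite_PiE) auto
    have cardK: "card (K q) = (2 * ((R + 1) * q) + 1) ^ CARD('n)" for q
    proof -
      have "nat (1 + (int q * 2 + int q * (int R * 2))) = Suc (2 * (q + R * q))"
        by (simp add: nat_eq_iff algebra_simps)
      then show ?thesis
        unfolding K_def by (subst card_PiE) (auto simp: algebra_simps)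
    qed
    have dB: "norm (x - y) \<le> D q" if "x \<in> B q p" "y \<in> B q p" for x y q p
    proof -
      have "norm (x - y) \<le> (\<Sum>i\<in>UNIV. \<bar>(x - y) $ i\<bar>)" by (rule norm_le_l1_cart)
      also have "\<dots> \<le> (\<Sum>i\<in>(UNIV::'n set). 2 * real q powr (-\<tau>))"
      proof (rule sum_mono)
        fix i :: 'n
        have "\<bar>x $ i - real_of_int (p i) / real q\<bar> < real q powr (-\<tau>)"
          "\<bar>y $ i - real_of_int (p i) / real q\<bar> < real q powr (-\<tau>)"
          using that by (auto simp: B_def)
        then show "\<bar>(x - y) $ i\<bar> \<le> 2 * real q powr (-\<tau>)" unfolding vector_minus_component by linarith
      qed
      finally show ?thesis by (simp add: D_def)
    qed
    have "hausdorff_measure s {x. infinite {q. x \<in> \<Union>(F q)}} = 0"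
    proof (rule hausdorff_null_limsup[OF s, where D = D])
      show "finite (F q)" for q using finK by (simp add: F_def)
      show "bounded A \<and> diameter A \<le> D q" if "A \<in> F q" for q A
      proof -
        obtain p where A: "A = B q p" using \<open>A \<in> F q\<close> by (auto simp: F_def split: if_splits)
        show ?thesis unfolding A
        proof
          show "diameter (B q p) \<le> D q"
            by (rule diameter_le) (use dB in \<open>auto simp: D_def\<close>)
          show "bounded (B q p)"
            unfolding bounded_two_points dist_norm using dB by blast
        qed
      qed
      \<comment> \<open>The first factor comes from
        \<open>2 * ((R + 1) * q) + 1 \<le> (2 * R + 3) * q\<close>, the second from the constant in
        \<open>D\<close>.\<close>
      let ?c = "real (2 * R + 3) ^ CARD('n) * (2 * real CARD('n)) powr s"
      show "summable (\<lambda>q. real (card (F q)) * D q powr s)"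
      proof (rule summable_comparison_test_ev)
        show "summable (\<lambda>q. ?c * (if q \<in> Q then real q powr (real CARD('n) - \<tau> * s) else 0))"
          by (rule summable_mult[OF sm])
        show "\<forall>\<^sub>F q in sequentially. norm (real (card (F q)) * D q powr s) \<le>
          ?c * (if q \<in> Q then real q powr (real CARD('n) - \<tau> * s) else 0)"
        proof (rule eventually_mono[OF eventually_ge_at_top[of 1]])
          fix q :: nat assume q: "1 \<le> q"
          show "norm (real (card (F q)) * D q powr s) \<le>
            ?c * (if q \<in> Q then real q powr (real CARD('n) - \<tau> * s) else 0)"
          proof (cases "q \<in> Q")
            case True
            have "card (F q) \<le> card (K q)" using True q finK by (simp add: F_def card_image_le)
            also have "\<dots> \<le> ((2 * R + 3) * q) ^ CARD('n)"
              unfolding cardK using q by (intro power_mono) (auto simp: algebra_simps)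
            finally have "real (card (F q)) \<le> real (((2 * R + 3) * q) ^ CARD('n))"
              by (rule of_nat_mono)
            also have "\<dots> = real (2 * R + 3) ^ CARD('n) * real q powr real CARD('n)"
              using q by (simp add: power_mult_distrib powr_realpow)
            finally have c: "real (card (F q)) \<le> real (2 * R + 3) ^ CARD('n) * real q powr real CARD('n)" .
            have "D q powr s = (2 * real CARD('n)) powr s * real q powr (- \<tau> * s)"
              unfolding D_def by (simp add: powr_mult powr_powr)
            then have "real (card (F q)) * D q powr s \<le>
              (real (2 * R + 3) ^ CARD('n) * real q powr real CARD('n)) * ((2 * real CARD('n)) powr s * real q powr (- \<tau> * s))"
              using c by (metis mult_right_mono powr_ge_zero)
            also have "\<dots> = ?c * (real q powr real CARD('n) * real q powr (- \<tau> * s))"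
              by simp
            also have "real q powr real CARD('n) * real q powr (- \<tau> * s) = real q powr (real CARD('n) - \<tau> * s)"
              by (simp add: powr_add[symmetric])
            finally show ?thesis using True by simp
          qed (simp add: F_def)
        qed
      qed
    qed
    moreover have "?W \<inter> {x. \<forall>i. \<bar>x $ i\<bar> \<le> real R} \<subseteq> {x. infinite {q. x \<in> \<Union>(F q)}}"
    proof safe
      fix x :: "real ^ 'n" assume xW: "x \<in> ?W" and xR: "\<forall>i. \<bar>x $ i\<bar> \<le> real R"
        and fin: "finite {q. x \<in> \<Union>(F q)}"
      have "{q \<in> Q. q \<ge> 1 \<and> (\<exists>p :: 'n \<Rightarrow> int. \<forall>i. \<bar>x $ i - real_of_int (p i) / real q\<bar> < real q powr (-\<tau>))}
        \<subseteq> {q. x \<in> \<Union>(F q)}"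
      proof safe
        fix q p assume q: "q \<in> Q" "q \<ge> 1"
          and p: "\<forall>i. \<bar>x $ i - real_of_int (p i) / real q\<bar> < real q powr (-\<tau>)"
        have "p i \<in> {- int ((R + 1) * q) .. int ((R + 1) * q)}" for i
        proof -
          have "real q powr (-\<tau>) \<le> 1"
            using q tau powr_mono[of "-\<tau>" 0 "real q"] by simp
          then have "\<bar>real_of_int (p i) / real q\<bar> \<le> real R + 1"
            using p[rule_format, of i] xR[rule_format, of i] by linarith
          then have "\<bar>real_of_int (p i)\<bar> \<le> (real R + 1) * real q"
            using q by (simp add: abs_divide divide_simps)
          then have "real_of_int \<bar>p i\<bar> \<le> real_of_int (int ((R + 1) * q))"
            by (simp add: algebra_simps)
          then show ?thesis unfolding of_int_le_iff by auto
        qed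
        then have "p \<in> K q" by (auto simp: K_def)
        then have "B q p \<in> F q" using q by (simp add: F_def)
        moreover have "x \<in> B q p" using p by (simp add: B_def)
        ultimately show "x \<in> \<Union>(F q)" by blast
      qed
      then show False using xW fin unfolding W_set_def by (auto dest: finite_subset)
    qed
    ultimately show ?thesis using hausdorff_null_subset[OF s] by blast
  qed
  have "?W \<subseteq> (\<Union>R::nat. ?W \<inter> {x. \<forall>i. \<bar>x $ i\<bar> \<le> real R})"
  proof
    fix x assume "x \<in> ?W"
    obtain R :: nat where "norm x \<le> real R" using real_arch_simple by blast
    then have "\<forall>i. \<bar>x $ i\<bar> \<le> real R" using component_le_norm_cart[of x] order_trans by blast
    then show "x \<in> (\<Union>R::nat. ?W \<inter> {x. \<forall>i. \<bar>x $ i\<bar> \<le> real R})" using \<open>x \<in> ?W\<close> by blast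
  qed
  then show ?thesis
    by (rule hausdorff_null_subset[OF s hausdorff_null_UN[OF s null]])
qed

section \<open>Rational points in cylinders\<close>

text \<open>The coordinates outside \<open>I\<close> stay free, so that volumes of dimension
  \<open>card I\<close> can be compared inside the full space.\<close>

definition cyl :: "'n::finite set \<Rightarrow> real ^ 'n \<Rightarrow> real \<Rightarrow> (real ^ 'n) set" where
  "cyl I c r = {x. \<forall>i\<in>I. \<bar>x $ i - c $ i\<bar> \<le> r}"

text \<open>Subadditivity of Lebesgue measure, with the common factor \<open>2 ^ card I\<close>
  cancelled.\<close>

lemma power_le_sum_of_cyl_cover:
  fixes I :: "'n::finite set"
  assumes J: "finite J" and cov: "cyl I c r \<subseteq> (\<Union>j\<in>J. cyl I (z j) (\<rho> j))"
    and r: "r \<ge> 0" and \<rho>: "\<And>j. j \<in> J \<Longrightarrow> \<rho> j \<ge> 0"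
  shows "r ^ card I \<le> (\<Sum>j\<in>J. \<rho> j ^ card I)"
proof -
  \<comment> \<open>Cutting the cylinders off at \<open>[0, 1]\<close> in the other coordinates makes their volumes finite.\<close>
  define K where "K c r = cbox (\<chi> i. if i \<in> I then c $ i - r else 0) (\<chi> i. if i \<in> I then c $ i + r else 1)"
    for c :: "real ^ 'n" and r
  have mem: "x \<in> K c r \<longleftrightarrow> x \<in> cyl I c r \<and> (\<forall>i. i \<notin> I \<longrightarrow> 0 \<le> x $ i \<and> x $ i \<le> 1)" for x c r
  proof -
    have "\<bar>x $ i - c $ i\<bar> \<le> r \<longleftrightarrow> c $ i - r \<le> x $ i \<and> x $ i \<le> c $ i + r" for i
      by linarith
    then show ?thesis
      unfolding K_def cyl_def mem_box_cart by auto
  qed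
  have meas: "measure lborel (K c r) = 2 ^ card I * r ^ card I" if "r \<ge> 0" for c r
  proof -
    have "(\<chi> i. if i \<in> I then c $ i else 0) \<in> K c r"
      using that by (auto simp: mem cyl_def)
    then have "K c r \<noteq> {}" by blast
    then have "measure lborel (K c r) =
        (\<Prod>i\<in>UNIV. (\<chi> i. if i \<in> I then c $ i + r else 1) $ i - (\<chi> i. if i \<in> I then c $ i - r else 0) $ i)"
      unfolding K_def by (rule content_cbox_cart)
    also have "\<dots> = (\<Prod>i\<in>UNIV. if i \<in> I then 2 * r else 1)"
      by (intro prod.cong) auto
    also have "\<dots> = (2 * r) ^ card I"
      by (simp add: prod.If_cases)
    finally show ?thesis by (simp add: power_mult_distrib)
  qed
  have "K c r \<subseteq> (\<Union>j\<in>J. K (z j) (\<rho> j))"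
    using cov by (auto simp: mem subset_iff)
  then have "measure lborel (K c r) \<le> measure lborel (\<Union>j\<in>J. K (z j) (\<rho> j))"
    by (rule measure_mono_fmeasurable) (auto simp: K_def intro!: J fmeasurable.finite_UN)
  also have "\<dots> \<le> (\<Sum>j\<in>J. measure lborel (K (z j) (\<rho> j)))"
    by (rule measure_UNION_le) (auto simp: K_def J)
  also have "\<dots> = (\<Sum>j\<in>J. 2 ^ card I * \<rho> j ^ card I)"
    by (intro sum.cong) (auto simp: meas \<rho>)
  finally have "2 ^ card I * r ^ card I \<le> 2 ^ card I * (\<Sum>j\<in>J. \<rho> j ^ card I)"
    using r by (simp add: meas sum_distrib_left)
  then show ?thesis by simp
qed

section \<open>Dirichlet approximation and the cost of small denominators\<close>

lemma simultaneous_Dirichlet: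
  fixes I :: "'n::finite set" and x :: "real ^ 'n"
  assumes "T > 0"
  obtains q :: nat and p :: "'n \<Rightarrow> int" where "1 \<le> q" "q \<le> T ^ card I"
    "\<And>i. i \<in> I \<Longrightarrow> \<bar>real q * x $ i - real_of_int (p i)\<bar> < 1 / real T"
proof -
  obtain h where h: "bij_betw h I {0..<card I}"
    using ex_bij_betw_finite_nat[of I] by auto
  obtain q p where qp: "0 < q" "q \<le> int (T ^ card I)"
    "\<And>j. j < card I \<Longrightarrow> \<bar>of_int q * x $ (inv_into I h j) - of_int (p j)\<bar> < 1 / real T"
    using Dirichlet_approx_simult[OF assms, of "card I" "\<lambda>j. x $ (inv_into I h j)"] by metis
  show ?thesis
  proof (rule that[of "nat q" "p \<circ> h"])
    show "\<bar>real (nat q) * x $ i - real_of_int ((p \<circ> h) i)\<bar> < 1 / real T" if "i \<in> I" for i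
    proof -
      have "h i < card I" using h that by (auto simp: bij_betw_def)
      moreover have "inv_into I h (h i) = i" using h that by (simp add: bij_betw_def)
      ultimately show ?thesis using qp(3)[of "h i"] qp(1) by simp
    qed
  qed (use qp in linarith)+
qed

lemma card_int_near_le:
  assumes "w \<ge> 0"
  shows "real (card {k::int. \<bar>real_of_int k - x\<bar> \<le> w}) \<le> 2 * w + 1"
proof -
  have "{k::int. \<bar>real_of_int k - x\<bar> \<le> w} = {\<lceil>x - w\<rceil>..\<lfloor>x + w\<rfloor>}"
    by (auto simp: ceiling_le_iff le_floor_iff abs_le_iff)
  moreover have "real (nat (\<lfloor>x + w\<rfloor> - \<lceil>x - w\<rceil> + 1)) \<le> 2 * w + 1"
    using assms by (cases "\<lfloor>x + w\<rfloor> - \<lceil>x - w\<rceil> + 1 \<ge> 0") (simp_all, linarith)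
  ultimately show ?thesis by (simp add: algebra_simps)
qed

lemma finite_int_near: "finite {k::int. \<bar>real_of_int k - x\<bar> \<le> w}"
proof -
  have "{k::int. \<bar>real_of_int k - x\<bar> \<le> w} = {\<lceil>x - w\<rceil>..\<lfloor>x + w\<rfloor>}"
    by (auto simp: ceiling_le_iff le_floor_iff abs_le_iff)
  then show ?thesis by simp
qed

text \<open>Where \<open>q * r \<ge> 3\<close> the term is at most \<open>(2 * r) ^ m\<close>, and
  there are at most \<open>N / C\<close> such \<open>q\<close>. At most \<open>3 / r\<close> other
  denominators remain, with terms at most \<open>(r + 3) ^ m\<close>; their total does not grow with
  \<open>N\<close>.\<close>

lemma sum_small_denominators_le:
  fixes C N m :: nat
  assumes r: "r > 0" and C: "C > 0"
  shows "(\<Sum>q\<in>{q. 1 \<le> q \<and> q * C < N}. (r + 3 / real q) ^ m) \<le>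
    real N / real C * (2 * r) ^ m + 3 / r * (r + 3) ^ m"
proof -
  define A where "A = {q. 1 \<le> q \<and> q * C < N}"
  define B where "B = {q\<in>A. real q * r < 3}"
  have A: "A \<subseteq> {1..N div C}"
    using C by (auto simp: A_def less_eq_div_iff_mult_less_eq)
  then have finA: "finite A" by (rule finite_subset) simp
  have "card A \<le> N div C" using card_mono[OF _ A] by simp
  then have cA: "real (card A) \<le> real N / real C"
    using of_nat_mono[of "card A" "N div C", where 'a = real]
    by (meson of_nat_div_le_of_nat order_trans)
  have "B \<subseteq> {1..nat \<lfloor>3 / r\<rfloor>}"
    using r by (auto simp: B_def A_def le_nat_iff le_floor_iff field_simps)
  from card_mono[OF _ this] have "card B \<le> nat \<lfloor>3 / r\<rfloor>" by simp
  then have cB: "real (card B) \<le> 3 / r" using r by (simp add: le_nat_iff le_floor_iff)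
  have "(\<Sum>q\<in>A. (r + 3 / real q) ^ m) \<le> (\<Sum>q\<in>A. (2 * r) ^ m + (if real q * r < 3 then (r + 3) ^ m else 0))"
  proof (rule sum_mono)
    fix q assume "q \<in> A"
    then have q: "real q \<ge> 1" by (simp add: A_def)
    show "(r + 3 / real q) ^ m \<le> (2 * r) ^ m + (if real q * r < 3 then (r + 3) ^ m else 0)"
    proof (cases "real q * r < 3")
      case True
      have "(r + 3 / real q) ^ m \<le> (r + 3) ^ m"
        using r q by (intro power_mono) (auto simp: field_simps)
      moreover have "(2 * r) ^ m \<ge> 0" using r by simp
      ultimately show ?thesis using True by simp
    next
      case False
      then have "(r + 3 / real q) ^ m \<le> (2 * r) ^ m"
        using r q by (intro power_mono) (auto simp: field_simps)
      then show ?thesis using False by simp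
    qed
  qed
  also have "\<dots> = real (card A) * (2 * r) ^ m + real (card B) * (r + 3) ^ m"
    using finA by (simp add: sum.distrib B_def sum.If_cases Int_def)
  also have "\<dots> \<le> real N / real C * (2 * r) ^ m + 3 / r * (r + 3) ^ m"
    using r by (intro add_mono mult_right_mono cA cB) auto
  finally show ?thesis by (simp add: A_def)
qed

text \<open>\<open>L\<close> lists the rational points with denominator below
  \<open>T ^ card I / C\<close> that Dirichlet's theorem may assign to a point of
  \<open>cyl I c (r / 2)\<close>; the \<open>+ 1\<close> allows for the error
  \<open>1 / T \<le> 1\<close>. Each \<open>q\<close> has at most
  \<open>(q * r + 3) ^ card I\<close> of them, and the value of \<open>C\<close> turns the main term
  into a quarter of \<open>(r / 2) ^ card I\<close>.\<close>

lemma small_denominator_cover_cost: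
  fixes I :: "'n::finite set" and c :: "real ^ 'n" and T C :: nat
  assumes r: "r > 0" and T: "T > 0" and C: "C = 4 ^ (card I + 1)"
  defines "L \<equiv> Sigma {q. 1 \<le> q \<and> q * C < T ^ card I}
    (\<lambda>q. PiE I (\<lambda>i. {k::int. \<bar>real_of_int k - real q * c $ i\<bar> \<le> real q * (r / 2) + 1}))"
  shows "finite L"
    and "(\<Sum>l\<in>L. (1 / (real (fst l) * real T)) ^ card I) \<le>
      (r / 2) ^ card I / 4 + 3 / r * (r + 3) ^ card I / real (T ^ card I)"
proof -
  define m where "m = card I"
  define A where "A = {q. 1 \<le> q \<and> q * C < T ^ m}"
  define PL where "PL q = PiE I (\<lambda>i. {k::int. \<bar>real_of_int k - real q * c $ i\<bar> \<le> real q * (r / 2) + 1})" for q :: nat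
  have L: "L = Sigma A PL" unfolding L_def A_def PL_def m_def ..
  have C0: "C > 0" by (simp add: C)
  have "A \<subseteq> {..T ^ m}"
  proof
    fix q assume "q \<in> A"
    then have "q * C < T ^ m" by (simp add: A_def)
    moreover have "q \<le> q * C" using C0 by simp
    ultimately show "q \<in> {..T ^ m}" unfolding atMost_iff by linarith
  qed
  then have finA: "finite A" by (rule finite_subset) simp
  have finP: "finite (PL q)" for q
    unfolding PL_def by (intro finite_PiE finite_int_near) auto
  show "finite L" unfolding L using finA finP by auto
  have cP: "real (card (PL q)) \<le> (real q * r + 3) ^ m" for q
  proof -
    have "real (card (PL q)) = (\<Prod>i\<in>I. real (card {k::int. \<bar>real_of_int k - real q * c $ i\<bar> \<le> real q * (r / 2) + 1}))"
      by (simp add: PL_def card_PiE)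
    also have "\<dots> \<le> (\<Prod>i\<in>I. real q * r + 3)"
    proof (intro prod_mono conjI)
      fix i
      show "real (card {k::int. \<bar>real_of_int k - real q * c $ i\<bar> \<le> real q * (r / 2) + 1}) \<le> real q * r + 3"
        using card_int_near_le[of "real q * (r / 2) + 1" "real q * c $ i"] r by simp
    qed simp
    finally show ?thesis by (simp add: m_def)
  qed
  have "(\<Sum>l\<in>L. (1 / (real (fst l) * real T)) ^ m) = (\<Sum>q\<in>A. \<Sum>p\<in>PL q. (1 / (real q * real T)) ^ m)"
    unfolding L using finA finP by (subst sum.Sigma) (auto intro!: sum.cong)
  also have "\<dots> = (\<Sum>q\<in>A. real (card (PL q)) * (1 / (real q * real T)) ^ m)"
    by simp
  also have "\<dots> \<le> (\<Sum>q\<in>A. (real q * r + 3) ^ m * (1 / (real q * real T)) ^ m)"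
    by (intro sum_mono mult_right_mono cP) auto
  also have "\<dots> = (\<Sum>q\<in>A. (r + 3 / real q) ^ m / real (T ^ m))"
  proof (rule sum.cong[OF refl])
    fix q assume "q \<in> A"
    then have "(real q * r + 3) * (1 / (real q * real T)) = (r + 3 / real q) / real T"
      using T by (simp add: A_def field_simps)
    then show "(real q * r + 3) ^ m * (1 / (real q * real T)) ^ m = (r + 3 / real q) ^ m / real (T ^ m)"
      unfolding power_mult_distrib[symmetric] by (simp add: power_divide)
  qed
  also have "\<dots> = (\<Sum>q\<in>A. (r + 3 / real q) ^ m) / real (T ^ m)"
    by (simp add: sum_divide_distrib)
  also have "\<dots> \<le> (real (T ^ m) / real C * (2 * r) ^ m + 3 / r * (r + 3) ^ m) / real (T ^ m)"
    unfolding A_def by (intro divide_right_mono sum_small_denominators_le r C0) auto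
  also have "\<dots> = (2 * r) ^ m / real C + 3 / r * (r + 3) ^ m / real (T ^ m)"
    using T by (simp add: add_divide_distrib)
  also have "(2 * r) ^ m / real C = (r / 2) ^ m / 4"
  proof -
    have "(2 * r) ^ m = (4 * (r / 2)) ^ m" by simp
    also have "\<dots> = 4 ^ m * (r / 2) ^ m" by (rule power_mult_distrib)
    finally show ?thesis by (simp add: C m_def)
  qed
  finally show "(\<Sum>l\<in>L. (1 / (real (fst l) * real T)) ^ card I) \<le>
      (r / 2) ^ card I / 4 + 3 / r * (r + 3) ^ card I / real (T ^ card I)"
    by (simp add: m_def)
qed

section \<open>Separated candidates and the choice of scale\<close>

text \<open>Greedy choice: an element is added unless it is close to one already selected, so
  whatever is left out is close to a selected element.\<close>

lemma separated_subset_exists: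
  assumes "finite P" "\<And>x. close x x" "\<And>x y. close x y \<Longrightarrow> close y x"
  shows "\<exists>S\<subseteq>P. (\<forall>x\<in>S. \<forall>y\<in>S. close x y \<longrightarrow> x = y) \<and> (\<forall>x\<in>P. \<exists>y\<in>S. close x y)"
  using assms(1)
proof (induction P rule: finite_induct)
  case (insert a P)
  then obtain S where S: "S \<subseteq> P" "\<forall>x\<in>S. \<forall>y\<in>S. close x y \<longrightarrow> x = y" "\<forall>x\<in>P. \<exists>y\<in>S. close x y"
    by blast
  show ?case
  proof (cases "\<exists>y\<in>S. close a y")
    case True
    then show ?thesis using S by (intro exI[of _ S]) auto
  next
    case False
    then have "\<forall>x\<in>S. \<not> close a x \<and> \<not> close x a" using assms(3) by meson
    then show ?thesis using S assms(2) by (intro exI[of _ "insert a S"]) auto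
  qed
qed simp

text \<open>Every requirement holds for all large \<open>T\<close>. In the second one
  \<open>s * \<tau> < m + 1\<close> makes the exponent of \<open>T ^ m\<close> negative; this is
  where \<open>s\<close> has to stay below \<open>(m + 1) / \<tau>\<close>.\<close>

lemma scale_exists:
  fixes m K C :: nat
  assumes m: "m > 0" and r: "r > 0" and s: "s * \<tau> < real m + 1" and tau: "\<tau> > 0"
    and \<eta>: "\<eta> > 0"
  obtains T :: nat where "T > 0"
    "3 / r * (r + 3) ^ m / real (T ^ m) \<le> (r / 2) ^ m / 4"
    "(real C + 4) ^ m * r powr s * \<eta> powr (-s) * real (T ^ m) powr (s * \<tau> - (real m + 1)) < (r / 2) ^ m / 4"
    "real C / real (T ^ m) \<le> r / 4"
    "\<eta> * real (T ^ m) powr (-\<tau>) \<le> r / 4"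
    "real (T ^ m) > real K * real C"
proof -
  have X: "filterlim (\<lambda>T::nat. real (T ^ m)) at_top sequentially"
    unfolding of_nat_power using m by (intro filterlim_pow_at_top filterlim_real_sequentially)
  have div: "((\<lambda>T::nat. b / real (T ^ m)) \<longlongrightarrow> 0) sequentially" for b
    by (intro tendsto_divide_0[OF tendsto_const] filterlim_at_top_imp_at_infinity X)
  have pw: "((\<lambda>T::nat. b * real (T ^ m) powr e) \<longlongrightarrow> 0) sequentially" if "e < 0" for b e
    by (intro tendsto_mult_right_zero tendsto_neg_powr X that)
  have c: "0 < (r / 2) ^ m / 4" "0 < r / 4" using r by auto
  have "\<forall>\<^sub>F T::nat in sequentially. T > 0 \<and>
    3 / r * (r + 3) ^ m / real (T ^ m) < (r / 2) ^ m / 4 \<and>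
    (real C + 4) ^ m * r powr s * \<eta> powr (-s) * real (T ^ m) powr (s * \<tau> - (real m + 1)) < (r / 2) ^ m / 4 \<and>
    real C / real (T ^ m) < r / 4 \<and>
    \<eta> * real (T ^ m) powr (-\<tau>) < r / 4 \<and>
    real (T ^ m) > real K * real C"
    using X s tau
    by (intro eventually_conj eventually_gt_at_top order_tendstoD(2)[OF div c(1)] order_tendstoD(2)[OF div c(2)]
        order_tendstoD(2)[OF pw c(1)] order_tendstoD(2)[OF pw c(2)])
      (auto simp: filterlim_at_top_dense)
  then obtain T :: nat where "T > 0 \<and>
    3 / r * (r + 3) ^ m / real (T ^ m) < (r / 2) ^ m / 4 \<and>
    (real C + 4) ^ m * r powr s * \<eta> powr (-s) * real (T ^ m) powr (s * \<tau> - (real m + 1)) < (r / 2) ^ m / 4 \<and>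
    real C / real (T ^ m) < r / 4 \<and>
    \<eta> * real (T ^ m) powr (-\<tau>) < r / 4 \<and>
    real (T ^ m) > real K * real C"
    using eventually_happens[of _ sequentially] by (metis (no_types, lifting) sequentially_bot)
  then show ?thesis by (intro that[of T]) auto
qed

section \<open>Avoiding a cover\<close>

text \<open>The invariant of the nested construction. Finite subfamilies stand in for the total
  cost, so that no summability has to be carried along.\<close>

definition light_on :: "(nat \<Rightarrow> (real ^ 'n) set) \<Rightarrow> (nat \<Rightarrow> real) \<Rightarrow> 'n::finite set \<Rightarrow> real \<Rightarrow> real \<Rightarrow> real ^ 'n \<Rightarrow> real \<Rightarrow> bool" where
  "light_on U d I s \<gamma> c r \<longleftrightarrow>
     (\<forall>F. finite F \<longrightarrow> (\<forall>k\<in>F. U k \<inter> cyl I c r \<noteq> {}) \<longrightarrow> (\<Sum>k\<in>F. d k powr s) \<le> \<gamma> * r powr s)"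

lemma light_step:
  fixes I :: "'n::finite set" and U :: "nat \<Rightarrow> (real ^ 'n) set" and a c :: "real ^ 'n" and K :: nat
  defines "m \<equiv> card I"
  defines "\<gamma> \<equiv> 1 / (4 * (2 * (4 ^ (m + 1) + 6)) ^ m) :: real"
  assumes I: "I \<noteq> {}" and s: "s > 0" and tau: "\<tau> \<ge> 1 + 1 / real m" and stau: "s * \<tau> < real m + 1"
    and \<eta>: "0 < \<eta>" "\<eta> \<le> 1"
    and d: "\<And>k. d k > 0"
    and U: "\<And>k x y i. x \<in> U k \<Longrightarrow> y \<in> U k \<Longrightarrow> i \<in> I \<Longrightarrow> \<bar>x $ i - y $ i\<bar> \<le> d k"
    and r: "r > 0" and light: "light_on U d I s \<gamma> c r"
  shows "\<exists>z \<rho>. light_on U d I s \<gamma> z \<rho> \<and> 0 < \<rho> \<and> \<rho> \<le> r / 4 \<and> cyl I z \<rho> \<subseteq> cyl I c r \<and>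
    (\<forall>i. i \<notin> I \<longrightarrow> z $ i = a $ i) \<and>
    (\<exists>q p. q > K \<and> \<rho> \<le> \<eta> * real q powr (-\<tau>) \<and> (\<forall>i\<in>I. z $ i = real_of_int (p i) / real q))"
proof -
  define C :: nat where "C = 4 ^ (m + 1)"
  have m: "m > 0" using I by (simp add: m_def card_gt_0_iff)
  have \<tau>0: "\<tau> > 0" using tau by (smt (verit) divide_nonneg_nonneg of_nat_0_le_iff)
  have "C > 0" by (simp add: C_def)
  then have C1: "real C \<ge> 1" by simp
  have \<gamma>0: "\<gamma> > 0" by (simp add: \<gamma>_def add_pos_pos)
  have \<gamma>C: "\<gamma> = 1 / (4 * (2 * (real C + 6)) ^ m)" by (simp add: \<gamma>_def C_def)
  have \<gamma>1: "\<gamma> \<le> 1"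
  proof -
    have "1 \<le> (2 * (real C + 6)) ^ m" using C1 by (intro one_le_power) simp
    then have "1 \<le> 4 * (2 * (real C + 6)) ^ m" by linarith
    then show ?thesis unfolding \<gamma>C by (rule divide_le_eq_1_pos[THEN iffD2, rotated]) (use C1 in auto)
  qed
  \<comment> \<open>Otherwise \<open>\<tau> \<ge> 1 + 1 / m\<close> would give
    \<open>s * \<tau> \<ge> m + 1\<close>. The bound allows \<open>d k ^ m\<close> to be compared
    with \<open>d k powr s\<close> for the large members.\<close>
  have sm: "s \<le> real m"
  proof (rule ccontr)
    assume "\<not> s \<le> real m"
    then have "real m * (1 + 1 / real m) \<le> s * \<tau>"
      using tau s by (intro mult_mono) auto
    moreover have "real m * (1 + 1 / real m) = real m + 1" using m by (simp add: field_simps)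
    ultimately show False using stau by simp
  qed
  obtain T :: nat where T: "T > 0"
    and T1: "3 / r * (r + 3) ^ m / real (T ^ m) \<le> (r / 2) ^ m / 4"
    and T2: "(real C + 4) ^ m * r powr s * \<eta> powr (-s) * real (T ^ m) powr (s * \<tau> - (real m + 1)) < (r / 2) ^ m / 4"
    and T3: "real C / real (T ^ m) \<le> r / 4"
    and T4: "\<eta> * real (T ^ m) powr (-\<tau>) \<le> r / 4"
    and T5: "real (T ^ m) > real K * real C"
    using scale_exists[OF m r stau \<tau>0 \<eta>(1), of C K] by blast
  \<comment> \<open>\<open>\<delta>\<close> is Dirichlet's accuracy \<open>1 / (q * T)\<close> at
    the largest denominator \<open>q = N\<close>, and \<open>\<rho>\<close> is the radius of the
    next cylinder; the bound on \<open>\<tau>\<close> yields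
    \<open>\<rho> \<le> \<delta>\<close>.\<close>
  define N where "N = T ^ m"
  define \<delta> where "\<delta> = 1 / (real T * real N)"
  define \<rho> where "\<rho> = \<eta> * real N powr (-\<tau>)"
  have N1: "real N \<ge> 1" using T by (simp add: N_def)
  have T1': "real T \<ge> 1" using T by simp
  have \<delta>0: "\<delta> > 0" using N1 T1' by (simp add: \<delta>_def)
  have \<rho>0: "\<rho> > 0" using N1 \<eta> by (simp add: \<rho>_def)
  have Tpowr: "real T = real N powr (1 / real m)"
    using T m by (simp add: N_def powr_realpow[symmetric] powr_powr)
  have \<delta>powr: "\<delta> = real N powr (-(1 + 1 / real m))"
  proof -
    have "real N powr (1 + 1 / real m) = real N * real T"
      unfolding powr_add Tpowr[symmetric] using N1 by simp
    then show ?thesis unfolding powr_minus \<delta>_def by (simp add: inverse_eq_divide mult.commute)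
  qed
  have \<rho>\<delta>: "\<rho> \<le> \<delta>"
  proof -
    have "\<rho> \<le> 1 * real N powr (-\<tau>)" unfolding \<rho>_def using \<eta> by (intro mult_right_mono) auto
    also have "\<dots> \<le> real N powr (-(1 + 1 / real m))" using N1 tau by (simp add: powr_mono)
    finally show ?thesis by (simp add: \<delta>powr)
  qed
  have \<delta>m: "\<delta> ^ m = real N powr (-(real m + 1))"
  proof -
    have "\<delta> ^ m = \<delta> powr real m" using \<delta>0 by (simp add: powr_realpow)
    also have "\<dots> = real N powr (-(1 + 1 / real m) * real m)" unfolding \<delta>powr by (rule powr_powr)
    also have "-(1 + 1 / real m) * real m = -(real m + 1)" using m by (simp add: field_simps)
    finally show ?thesis .
  qed
  have C\<delta>: "real C * \<delta> \<le> r / 4"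
  proof -
    have "real C * \<delta> \<le> real C / real N"
      unfolding \<delta>_def using N1 T1' mult_left_mono[OF T1', of "real C"] by (simp add: divide_simps)
    then show ?thesis using T3 unfolding N_def[symmetric] by linarith
  qed

  \<comment> \<open>Candidate centres. The margin \<open>3 * r / 4\<close> is \<open>r / 2\<close>
    for the approximated point plus \<open>C * \<delta> \<le> r / 4\<close> for the error; the last
    quarter is kept for \<open>\<rho>\<close>.\<close>
  define P where "P = {z. (\<forall>i. i \<notin> I \<longrightarrow> z $ i = a $ i) \<and> (\<forall>i\<in>I. \<bar>z $ i - c $ i\<bar> \<le> 3 * r / 4) \<and>
    (\<exists>q p. N \<le> q * C \<and> q \<le> N \<and> (\<forall>i\<in>I. z $ i = real_of_int (p i) / real q))}"
  \<comment> \<open>If two cylinders of radius \<open>\<rho> \<le> \<delta>\<close> meet a common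
    set of size at most \<open>\<delta>\<close>, their centres differ by at most
    \<open>3 * \<delta>\<close> in each coordinate of \<open>I\<close>, so they are close.\<close>
  define close where "close x y \<longleftrightarrow> (\<forall>i\<in>I. \<bar>x $ i - y $ i\<bar> \<le> 4 * \<delta>)" for x y :: "real ^ 'n"
  have finP: "finite P"
  proof -
    define g where "g = (\<lambda>(q :: nat, p :: 'n \<Rightarrow> int). (\<chi> i. if i \<in> I then real_of_int (p i) / real q else a $ i) :: real ^ 'n)"
    define A where "A = Sigma {..N} (\<lambda>q. PiE I (\<lambda>i. {k::int. \<bar>real_of_int k - real q * c $ i\<bar> \<le> real q * (3 * r / 4)}))"
    have "finite A" unfolding A_def by (intro finite_SigmaI finite_PiE finite_int_near) auto
    moreover have "P \<subseteq> g ` A"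
    proof
      fix z assume "z \<in> P"
      then obtain q p where z: "\<And>i. i \<notin> I \<Longrightarrow> z $ i = a $ i" "\<And>i. i \<in> I \<Longrightarrow> \<bar>z $ i - c $ i\<bar> \<le> 3 * r / 4"
        "N \<le> q * C" "q \<le> N" "\<And>i. i \<in> I \<Longrightarrow> z $ i = real_of_int (p i) / real q"
        unfolding P_def by blast
      have q0: "real q > 0" using z(3) N1 by (cases "q = 0") auto
      have "\<bar>real_of_int (p i) - real q * c $ i\<bar> \<le> real q * (3 * r / 4)" if "i \<in> I" for i
      proof -
        have "real_of_int (p i) - real q * c $ i = real q * (z $ i - c $ i)"
          using z(5)[OF that] q0 by (simp add: field_simps)
        then show ?thesis using z(2)[OF that] q0 by (simp add: abs_mult)
      qed
      then have "(q, restrict p I) \<in> A" using z(4) by (simp add: A_def)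
      moreover have "z = g (q, restrict p I)" using z by (simp add: g_def vec_eq_iff)
      ultimately show "z \<in> g ` A" by blast
    qed
    ultimately show ?thesis by (rule finite_surj)
  qed
  have "\<exists>S\<subseteq>P. (\<forall>x\<in>S. \<forall>y\<in>S. close x y \<longrightarrow> x = y) \<and> (\<forall>x\<in>P. \<exists>y\<in>S. close x y)"
    using \<delta>0 by (intro separated_subset_exists finP) (auto simp: close_def abs_minus_commute)
  then obtain S where S: "S \<subseteq> P" "\<And>x y. x \<in> S \<Longrightarrow> y \<in> S \<Longrightarrow> close x y \<Longrightarrow> x = y"
    "\<And>x. x \<in> P \<Longrightarrow> \<exists>y\<in>S. close x y"
    by metis
  \<comment> \<open>Selected candidates whose cylinders are met by no large member; a small member
    can be charged to at most one of them.\<close>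
  define S' where "S' = {z\<in>S. \<forall>k. U k \<inter> cyl I z \<rho> \<noteq> {} \<longrightarrow> d k \<le> \<delta>}"
  have finS': "finite S'" using finP S(1) finite_subset[of S' P] by (auto simp: S'_def)
  have sub: "cyl I z \<rho> \<subseteq> cyl I c r" if "z \<in> P" for z
  proof
    fix x assume x: "x \<in> cyl I z \<rho>"
    have "\<bar>x $ i - c $ i\<bar> \<le> r" if "i \<in> I" for i
    proof -
      have "\<bar>x $ i - z $ i\<bar> \<le> \<rho>" "\<bar>z $ i - c $ i\<bar> \<le> 3 * r / 4"
        using x \<open>z \<in> P\<close> that by (auto simp: cyl_def P_def)
      moreover have "\<rho> \<le> r / 4" using T4 unfolding \<rho>_def N_def .
      ultimately show ?thesis by linarith
    qed
    then show "x \<in> cyl I c r" by (simp add: cyl_def)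
  qed

  \<comment> \<open>Otherwise \<open>cyl I c (r / 2)\<close> is covered by cylinders of three kinds whose volumes add up to too little:
    around rationals with small denominators (\<open>L\<close>), around \<open>S'\<close>, and around large members of the cover (\<open>Big\<close>).\<close>
  have "\<exists>z\<in>S'. light_on U d I s \<gamma> z \<rho>"
  proof (rule ccontr)
    assume "\<not> ?thesis"
    then have "\<forall>z\<in>S'. \<exists>F. finite F \<and> (\<forall>k\<in>F. U k \<inter> cyl I z \<rho> \<noteq> {}) \<and> \<gamma> * \<rho> powr s \<le> (\<Sum>k\<in>F. d k powr s)"
      unfolding light_on_def by (meson linear)
    then obtain F where F: "\<And>z. z \<in> S' \<Longrightarrow> finite (F z)"
      "\<And>z k. z \<in> S' \<Longrightarrow> k \<in> F z \<Longrightarrow> U k \<inter> cyl I z \<rho> \<noteq> {}"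
      "\<And>z. z \<in> S' \<Longrightarrow> \<gamma> * \<rho> powr s \<le> (\<Sum>k\<in>F z. d k powr s)"
      by metis
    \<comment> \<open>A shared member has size at most \<open>\<delta>\<close>, so the two centres
      would be close, against the separation of \<open>S\<close>.\<close>
    have disj: "F z \<inter> F w = {}" if zw: "z \<in> S'" "w \<in> S'" "z \<noteq> w" for z w
    proof (rule ccontr)
      assume "F z \<inter> F w \<noteq> {}"
      then obtain k where k: "k \<in> F z" "k \<in> F w" by blast
      obtain x where x: "x \<in> U k" "x \<in> cyl I z \<rho>" using F(2)[OF zw(1) k(1)] by blast
      obtain y where y: "y \<in> U k" "y \<in> cyl I w \<rho>" using F(2)[OF zw(2) k(2)] by blast
      have dk: "d k \<le> \<delta>" using zw(1) x by (auto simp: S'_def)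
      have "close z w" unfolding close_def
      proof
        fix i assume i: "i \<in> I"
        have "\<bar>x $ i - z $ i\<bar> \<le> \<rho>" "\<bar>y $ i - w $ i\<bar> \<le> \<rho>" using x y i by (auto simp: cyl_def)
        then show "\<bar>z $ i - w $ i\<bar> \<le> 4 * \<delta>" using U[OF x(1) y(1) i] dk \<rho>\<delta> \<delta>0 by linarith
      qed
      then show False using S(2)[of z w] zw by (auto simp: S'_def)
    qed
    \<comment> \<open>By disjointness the costs add up to at most the budget of
      \<open>cyl I c r\<close>, which gives
      \<open>card S' \<le> (r / \<rho>) powr s\<close>.\<close>
    have "real (card S') * (\<gamma> * \<rho> powr s) = (\<Sum>z\<in>S'. \<gamma> * \<rho> powr s)" by simp
    also have "\<dots> \<le> (\<Sum>z\<in>S'. \<Sum>k\<in>F z. d k powr s)" by (intro sum_mono F(3))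
    also have "\<dots> = (\<Sum>k\<in>(\<Union>z\<in>S'. F z). d k powr s)"
      using finS' F(1) disj by (intro sum.UNION_disjoint[symmetric]) auto
    also have "\<dots> \<le> \<gamma> * r powr s"
    proof -
      have "finite (\<Union>z\<in>S'. F z)" using finS' F(1) by blast
      moreover have "U k \<inter> cyl I c r \<noteq> {}" if k: "k \<in> (\<Union>z\<in>S'. F z)" for k
      proof -
        obtain z where z: "z \<in> S'" "k \<in> F z" using k by blast
        then have "z \<in> P" using S(1) by (auto simp: S'_def)
        then show ?thesis using sub[of z] F(2)[OF z] by blast
      qed
      ultimately show ?thesis using light unfolding light_on_def by blast
    qed
    finally have cS': "real (card S') * \<rho> powr s \<le> r powr s"
      using \<gamma>0 by (simp add: mult.left_commute)
    \<comment> \<open>The radius \<open>(C + 4) * \<delta>\<close> is Dirichlet's error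
      \<open>C * \<delta>\<close> plus the separation \<open>4 * \<delta>\<close>. As
      \<open>\<rho>\<close> is of order \<open>N powr -\<tau>\<close> and
      \<open>\<delta> ^ m = N powr -(m + 1)\<close>, the total is of order
      \<open>N powr (s * \<tau> - (m + 1))\<close>.\<close>
    have costS: "real (card S') * ((real C + 4) * \<delta>) ^ m < (r / 2) ^ m / 4"
    proof -
      have inv: "\<rho> powr s * (\<eta> powr (-s) * real N powr (s * \<tau>)) = 1"
      proof -
        have "\<rho> powr s = \<eta> powr s * real N powr (-(s * \<tau>))"
          unfolding \<rho>_def by (simp add: powr_mult powr_powr mult.commute)
        moreover have "\<eta> powr (-s) * \<eta> powr s = 1" "real N powr (-(s * \<tau>)) * real N powr (s * \<tau>) = 1"
          using \<eta> N1 unfolding powr_add[symmetric] by auto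
        ultimately show ?thesis by (simp add: mult.assoc mult.left_commute)
      qed
      have "real (card S') = real (card S') * \<rho> powr s * (\<eta> powr (-s) * real N powr (s * \<tau>))"
        using inv by (simp add: mult.assoc)
      also have "\<dots> \<le> r powr s * (\<eta> powr (-s) * real N powr (s * \<tau>))"
        using cS' by (intro mult_right_mono) auto
      finally have "real (card S') * ((real C + 4) * \<delta>) ^ m \<le>
        (r powr s * (\<eta> powr (-s) * real N powr (s * \<tau>))) * ((real C + 4) * \<delta>) ^ m"
        using \<delta>0 by (intro mult_right_mono) auto
      also have "\<dots> = (real C + 4) ^ m * r powr s * \<eta> powr (-s) * (real N powr (s * \<tau>) * \<delta> ^ m)"
        by (simp add: power_mult_distrib)
      also have "real N powr (s * \<tau>) * \<delta> ^ m = real N powr (s * \<tau> - (real m + 1))"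
        unfolding \<delta>m powr_add[symmetric] by (simp add: algebra_simps)
      finally show ?thesis using T2 unfolding N_def[symmetric] by linarith
    qed
    define Big where "Big = {k. \<delta> < d k \<and> U k \<inter> cyl I c r \<noteq> {}}"
    \<comment> \<open>A single member larger than \<open>r\<close> would by itself exceed the
      budget, as \<open>\<gamma> \<le> 1\<close>.\<close>
    have hit_le: "d k \<le> r" if "U k \<inter> cyl I c r \<noteq> {}" for k
    proof (rule ccontr)
      assume "\<not> d k \<le> r"
      then have "r powr s < d k powr s" using r s by (intro powr_less_mono2) auto
      moreover have "(\<Sum>j\<in>{k}. d j powr s) \<le> \<gamma> * r powr s"
        using light that unfolding light_on_def by blast
      moreover have "\<gamma> * r powr s \<le> 1 * r powr s" using \<gamma>1 by (intro mult_right_mono) auto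
      ultimately show False by simp
    qed
    \<comment> \<open>Each member of \<open>Big\<close> costs at least
      \<open>\<delta> powr s\<close>, so the budget bounds the cardinality of all finite
      subsets.\<close>
    have finB: "finite Big"
    proof -
      have "card G \<le> nat \<lfloor>\<gamma> * r powr s / \<delta> powr s\<rfloor>" if G: "G \<subseteq> Big" "finite G" for G
      proof -
        have "real (card G) * \<delta> powr s = (\<Sum>k\<in>G. \<delta> powr s)" by simp
        also have "\<dots> \<le> (\<Sum>k\<in>G. d k powr s)"
          using G(1) s \<delta>0 by (intro sum_mono powr_mono2) (auto simp: Big_def)
        also have "\<dots> \<le> \<gamma> * r powr s"
        proof -
          have "\<forall>k\<in>G. U k \<inter> cyl I c r \<noteq> {}" using G(1) unfolding Big_def by blast
          then show ?thesis using light G(2) unfolding light_on_def by blast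
        qed
        finally have "real (card G) \<le> \<gamma> * r powr s / \<delta> powr s" using \<delta>0 by (simp add: field_simps)
        then show ?thesis using le_nat_floor by blast
      qed
      then show ?thesis using finite_if_finite_subsets_card_bdd[of Big] by blast
    qed
    \<comment> \<open>For \<open>d k \<le> r\<close> one has
      \<open>d k ^ m \<le> r powr (m - s) * d k powr s\<close>; the factor
      \<open>(C + 6) ^ m\<close> is cancelled by the one in \<open>\<gamma>\<close>.\<close>
    have costB: "(\<Sum>k\<in>Big. ((real C + 6) * d k) ^ m) \<le> (r / 2) ^ m / 4"
    proof -
      have "(\<Sum>k\<in>Big. ((real C + 6) * d k) ^ m) \<le> (\<Sum>k\<in>Big. (real C + 6) ^ m * r powr (real m - s) * d k powr s)"
      proof (rule sum_mono)
        fix k assume "k \<in> Big"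
        then have "d k \<le> r" using hit_le by (simp add: Big_def)
        then have "d k powr (real m - s) \<le> r powr (real m - s)"
          using d[of k] sm by (intro powr_mono2) auto
        moreover have "d k ^ m = d k powr (real m - s) * d k powr s"
          using d[of k] by (simp add: powr_add[symmetric] powr_realpow)
        ultimately have "d k ^ m \<le> r powr (real m - s) * d k powr s"
          by (simp add: mult_right_mono)
        then show "((real C + 6) * d k) ^ m \<le> (real C + 6) ^ m * r powr (real m - s) * d k powr s"
          unfolding power_mult_distrib mult.assoc by (intro mult_left_mono) auto
      qed
      also have "\<dots> = (real C + 6) ^ m * r powr (real m - s) * (\<Sum>k\<in>Big. d k powr s)"
        by (simp add: sum_distrib_left)
      also have "\<dots> \<le> (real C + 6) ^ m * r powr (real m - s) * (\<gamma> * r powr s)"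
      proof (rule mult_left_mono)
        have "\<forall>k\<in>Big. U k \<inter> cyl I c r \<noteq> {}" unfolding Big_def by blast
        then show "(\<Sum>k\<in>Big. d k powr s) \<le> \<gamma> * r powr s"
          using light finB unfolding light_on_def by blast
      qed simp
      also have "\<dots> = (real C + 6) ^ m * \<gamma> * (r powr (real m - s) * r powr s)" by simp
      also have "r powr (real m - s) * r powr s = r ^ m"
        using r by (simp add: powr_add[symmetric] powr_realpow)
      also have "(real C + 6) ^ m * \<gamma> * r ^ m = (r / 2) ^ m / 4"
        unfolding \<gamma>C power_mult_distrib power_divide using C1 by simp
      finally show ?thesis .
    qed
    define L where "L = Sigma {q. 1 \<le> q \<and> q * C < T ^ card I}
      (\<lambda>q. PiE I (\<lambda>i. {k::int. \<bar>real_of_int k - real q * c $ i\<bar> \<le> real q * (r / 2) + 1}))"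
    have Ceq: "C = 4 ^ (card I + 1)" by (simp add: C_def m_def)
    have finL: "finite L" unfolding L_def by (rule small_denominator_cover_cost(1)[OF r T Ceq])
    have costL: "(\<Sum>l\<in>L. (1 / (real (fst l) * real T)) ^ m) \<le> (r / 2) ^ m / 4 + (r / 2) ^ m / 4"
      using small_denominator_cover_cost(2)[OF r T Ceq, of c] T1 unfolding L_def m_def by linarith
    \<comment> \<open>An arbitrary point of \<open>U k\<close> serves as the centre of the cylinder
      that replaces it.\<close>
    define u where "u k = (SOME x. x \<in> U k)" for k
    have u: "u k \<in> U k" if "U k \<noteq> {}" for k
      unfolding u_def using that some_in_eq by blast
    \<comment> \<open>Centres and radii of the three kinds, indexed by a disjoint sum so that one
      volume comparison treats them together.\<close>
    define zz :: "nat \<times> ('n \<Rightarrow> int) + (real ^ 'n) + nat \<Rightarrow> real ^ 'n" where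
      "zz = case_sum (\<lambda>(q, p). \<chi> i. real_of_int (p i) / real q) (case_sum (\<lambda>z. z) u)"
    define rr :: "nat \<times> ('n \<Rightarrow> int) + (real ^ 'n) + nat \<Rightarrow> real" where
      "rr = case_sum (\<lambda>l. 1 / (real (fst l) * real T)) (case_sum (\<lambda>z. (real C + 4) * \<delta>) (\<lambda>k. (real C + 6) * d k))"
    define J where "J = L <+> (S' <+> Big)"
    have cover: "\<exists>j\<in>J. x \<in> cyl I (zz j) (rr j)" if x: "x \<in> cyl I c (r / 2)" for x
    proof -
      obtain q p where q: "1 \<le> q" "q \<le> T ^ card I"
        and p: "\<And>i. i \<in> I \<Longrightarrow> \<bar>real q * x $ i - real_of_int (p i)\<bar> < 1 / real T"
        using simultaneous_Dirichlet[OF T] by metis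
      have q0: "real q > 0" using q by simp
      have xz: "\<bar>x $ i - real_of_int (p i) / real q\<bar> \<le> 1 / (real q * real T)" if "i \<in> I" for i
      proof -
        have "\<bar>x $ i - real_of_int (p i) / real q\<bar> = \<bar>real q * x $ i - real_of_int (p i)\<bar> / real q"
        proof -
          have "x $ i - real_of_int (p i) / real q = (real q * x $ i - real_of_int (p i)) / real q"
            using q0 by (simp add: diff_divide_distrib)
          then show ?thesis by (simp only: abs_divide abs_of_nat)
        qed
        also have "\<dots> \<le> (1 / real T) / real q" using p[OF that] q0 by (intro divide_right_mono) auto
        finally show ?thesis by (simp add: mult.commute)
      qed
      have xc: "\<bar>x $ i - c $ i\<bar> \<le> r / 2" if "i \<in> I" for i using x that by (simp add: cyl_def)
      show ?thesis
      \<comment> \<open>A small denominator gives an element of \<open>L\<close>. A large one gives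
        a candidate, whose neighbour in \<open>S\<close> either lies in \<open>S'\<close> or is met
        by a large member.\<close>
      proof (cases "q * C < N")
        case True
        have "\<bar>real_of_int (p i) - real q * c $ i\<bar> \<le> real q * (r / 2) + 1" if "i \<in> I" for i
        proof -
          have "\<bar>real q * x $ i - real q * c $ i\<bar> \<le> real q * (r / 2)"
            using xc[OF that] q0 by (simp add: right_diff_distrib[symmetric] abs_mult)
          moreover have "1 / real T \<le> 1" using T1' by simp
          ultimately show ?thesis using p[OF that] by linarith
        qed
        then have "(q, restrict p I) \<in> L" using q True by (simp add: L_def N_def m_def)
        then have "Inl (q, restrict p I) \<in> J" unfolding J_def by (intro InlI InrI)
        moreover have "x \<in> cyl I (zz (Inl (q, restrict p I))) (rr (Inl (q, restrict p I)))"
          using xz by (simp add: cyl_def zz_def rr_def)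
        ultimately show ?thesis by blast
      next
        case False
        define z :: "real ^ 'n" where "z = (\<chi> i. if i \<in> I then real_of_int (p i) / real q else a $ i)"
        have "1 / (real q * real T) \<le> real C * \<delta>"
        proof -
          have "real N \<le> real q * real C" using False by (metis not_less of_nat_le_iff of_nat_mult)
          then show ?thesis unfolding \<delta>_def using N1 T1' q0 by (simp add: field_simps)
        qed
        then have xz': "\<bar>x $ i - z $ i\<bar> \<le> real C * \<delta>" if "i \<in> I" for i
          using xz[OF that] that by (simp add: z_def)
        have "\<bar>z $ i - c $ i\<bar> \<le> 3 * r / 4" if "i \<in> I" for i
          using xz'[OF that] xc[OF that] C\<delta> by linarith
        moreover have "\<exists>q p. N \<le> q * C \<and> q \<le> N \<and> (\<forall>i\<in>I. z $ i = real_of_int (p i) / real q)"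
          using False q by (intro exI[of _ q] exI[of _ p]) (auto simp: z_def N_def m_def)
        ultimately have "z \<in> P" unfolding P_def by (simp add: z_def)
        then obtain w where w: "w \<in> S" "close z w" using S(3) by blast
        have xw: "\<bar>x $ i - w $ i\<bar> \<le> (real C + 4) * \<delta>" if "i \<in> I" for i
        proof -
          have "\<bar>z $ i - w $ i\<bar> \<le> 4 * \<delta>" using w(2) that by (simp add: close_def)
          then show ?thesis using xz'[OF that] unfolding distrib_right by linarith
        qed
        show ?thesis
        proof (cases "w \<in> S'")
          case True
          then have "Inr (Inl w) \<in> J" unfolding J_def by (intro InlI InrI)
          moreover have "x \<in> cyl I (zz (Inr (Inl w))) (rr (Inr (Inl w)))"
            using xw by (simp add: cyl_def zz_def rr_def)
          ultimately show ?thesis by blast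
        next
          case False
          then obtain k where k: "U k \<inter> cyl I w \<rho> \<noteq> {}" "\<delta> < d k"
            using w(1) unfolding S'_def by (auto simp: not_le)
          then obtain y where y: "y \<in> U k" "y \<in> cyl I w \<rho>" by blast
          have "w \<in> P" using w S(1) by blast
          then have "U k \<inter> cyl I c r \<noteq> {}" using k sub[of w] by blast
          then have "k \<in> Big" using k by (simp add: Big_def)
          then have "Inr (Inr k) \<in> J" unfolding J_def by (intro InlI InrI)
          moreover have "x \<in> cyl I (zz (Inr (Inr k))) (rr (Inr (Inr k)))"
          proof -
            \<comment> \<open>The way from \<open>x\<close> to \<open>w\<close>, to the common point
              \<open>y\<close>, to \<open>u k\<close> adds up to
              \<open>(C + 4) * \<delta> + \<rho> + d k\<close>, where \<open>\<delta>\<close> and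
              \<open>\<rho>\<close> are below \<open>d k\<close>.\<close>
            have "\<bar>x $ i - u k $ i\<bar> \<le> (real C + 6) * d k" if i: "i \<in> I" for i
            proof -
              have "u k \<in> U k" using u y by blast
              then have "\<bar>y $ i - u k $ i\<bar> \<le> d k" using U y i by blast
              moreover have "\<bar>y $ i - w $ i\<bar> \<le> \<rho>" using y i by (simp add: cyl_def)
              moreover have "(real C + 4) * \<delta> \<le> (real C + 4) * d k" using k by (intro mult_left_mono) auto
              ultimately show ?thesis using xw[OF i] k(2) \<rho>\<delta> unfolding distrib_right by linarith
            qed
            then show ?thesis by (simp add: cyl_def zz_def rr_def)
          qed
          ultimately show ?thesis by blast
        qed
      qed
    qed
    have finJ: "finite J" using finL finS' finB by (simp add: J_def)
    have rr0: "rr j \<ge> 0" for j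
      using \<delta>0 d less_imp_le[OF d] by (auto simp: rr_def split: sum.split)
    have "(r / 2) ^ m \<le> (\<Sum>j\<in>J. rr j ^ m)"
      unfolding m_def by (rule power_le_sum_of_cyl_cover[where z = zz]) (use finJ cover rr0 r in auto)
    also have "\<dots> = (\<Sum>l\<in>L. (1 / (real (fst l) * real T)) ^ m) +
        (real (card S') * ((real C + 4) * \<delta>) ^ m + (\<Sum>k\<in>Big. ((real C + 6) * d k) ^ m))"
      unfolding J_def using finL finS' finB by (simp add: sum.Plus rr_def)
    also have "\<dots> < (r / 2) ^ m" using costL costS costB by linarith
    finally show False by simp
  qed
  then obtain z where z: "z \<in> S'" "light_on U d I s \<gamma> z \<rho>" by blast
  then have zP: "z \<in> P" using S(1) by (auto simp: S'_def)
  then obtain q p where q: "N \<le> q * C" "q \<le> N" "\<forall>i\<in>I. z $ i = real_of_int (p i) / real q"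
    unfolding P_def by blast
  have q0: "real q > 0" using q(1) N1 by (cases "q = 0") auto
  \<comment> \<open>\<open>T5\<close> and the lower bound \<open>N \<le> q * C\<close> push the
    denominator beyond \<open>K\<close>.\<close>
  have "K * C < q * C" using T5 q(1) unfolding N_def[symmetric] by (metis less_le_trans of_nat_less_iff of_nat_mult)
  then have "K < q" by simp
  moreover have "\<rho> \<le> \<eta> * real q powr (-\<tau>)"
    unfolding \<rho>_def using \<eta> q(2) q0 \<tau>0 by (intro mult_left_mono powr_mono2') auto
  moreover have "\<rho> \<le> r / 4" using T4 unfolding \<rho>_def N_def .
  moreover have "\<forall>i. i \<notin> I \<longrightarrow> z $ i = a $ i" using zP by (simp add: P_def)
  ultimately show ?thesis using z(2) \<rho>0 sub[OF zP] q(3) by blast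
qed

section \<open>The limit of the nested cylinders\<close>

text \<open>A null set would have a cover that is light on the unit cylinder about \<open>a\<close>,
  and iterating \<open>light_step\<close> leads to a point of the set outside every member. The
  factor \<open>\<eta>\<close> later absorbs the passage to strict inequalities and to multiples of
  a denominator.\<close>

lemma hausdorff_measure_well_approximable_neq_0:
  fixes I :: "'n::finite set" and a :: "real ^ 'n"
  assumes I: "I \<noteq> {}" and s: "s > 0" and tau: "\<tau> \<ge> 1 + 1 / real (card I)"
    and stau: "s * \<tau> < real (card I) + 1" and \<eta>: "0 < \<eta>" "\<eta> \<le> 1"
  shows "hausdorff_measure s {x. (\<forall>i. i \<notin> I \<longrightarrow> x $ i = a $ i) \<and>
    infinite {q. q \<ge> 1 \<and> (\<exists>p. \<forall>i\<in>I. \<bar>x $ i - real_of_int (p i) / real q\<bar> \<le> \<eta> * real q powr (-\<tau>))}} \<noteq> 0"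
    (is "hausdorff_measure s ?E \<noteq> 0")
proof
  define E where "E = ?E"
  assume "hausdorff_measure s ?E = 0"
  then have null: "hausdorff_measure s E = 0" unfolding E_def .
  define \<gamma> :: real where "\<gamma> = 1 / (4 * (2 * (4 ^ (card I + 1) + 6)) ^ card I)"
  have \<gamma>0: "\<gamma> > 0" by (simp add: \<gamma>_def add_pos_pos)
  have \<gamma>1: "\<gamma> \<le> 1"
  proof -
    have "1 \<le> (2 * (4 ^ (card I + 1) + 6) :: real)"
      by (simp add: add_increasing)
    then have "1 \<le> (2 * (4 ^ (card I + 1) + 6) :: real) ^ card I" by (rule one_le_power)
    then show ?thesis unfolding \<gamma>_def by (subst divide_le_eq_1) linarith
  qed
  \<comment> \<open>Half of the budget \<open>\<gamma>\<close> pays for the cover, the other half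
    for the padding in \<open>d\<close>.\<close>
  have "\<gamma> / 2 > 0" using \<gamma>0 by simp
  then obtain U :: "nat \<Rightarrow> (real ^ 'n) set" where
    U: "E \<subseteq> (\<Union>k. U k) \<and> (\<forall>k. bounded (U k)) \<and>
      (\<Sum>k. ennreal (diameter (U k) powr s)) \<le> ennreal (\<gamma> / 2)"
    using null[unfolded hausdorff_null_iff[OF s]] by blast
  note cov = U[THEN conjunct1] and bd = U[THEN conjunct2, THEN conjunct1, rule_format]
    and sumU = U[THEN conjunct2, THEN conjunct2]
  \<comment> \<open>The sizes are made positive so that members of diameter \<open>0\<close> are avoided as well.\<close>
  define d where "d k = (diameter (U k) powr s + \<gamma> / 2 * (1 / 2) ^ Suc k) powr (1 / s)" for k
  have pos: "diameter (U k) powr s + \<gamma> / 2 * (1 / 2) ^ Suc k > 0" for k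
    using \<gamma>0 by (intro add_nonneg_pos) auto
  have d0: "d k > 0" for k unfolding d_def using pos[of k] by (simp only: powr_gt_zero)
  have ds: "d k powr s = diameter (U k) powr s + \<gamma> / 2 * (1 / 2) ^ Suc k" for k
    unfolding d_def powr_powr using s pos[of k] by (simp del: power_Suc)
  have dU: "\<bar>x $ i - y $ i\<bar> \<le> d k" if "x \<in> U k" "y \<in> U k" for x y k i
  proof -
    have "\<bar>x $ i - y $ i\<bar> \<le> norm (x - y)" using component_le_norm_cart[of "x - y" i] by simp
    also have "\<dots> \<le> diameter (U k)"
      using diameter_bounded_bound[OF bd that] by (simp add: dist_norm)
    also have "\<dots> \<le> d k"
    proof (rule ccontr)
      assume "\<not> diameter (U k) \<le> d k"
      then have "d k powr s < diameter (U k) powr s" using d0[of k] s by (intro powr_less_mono2) auto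
      moreover have "\<gamma> / 2 * (1 / 2) ^ Suc k > 0" using \<gamma>0 by simp
      ultimately show False unfolding ds by linarith
    qed
    finally show ?thesis .
  qed
  have light0: "light_on U d I s \<gamma> a 1"
    unfolding light_on_def
  proof (intro allI impI)
    fix F :: "nat set" assume F: "finite F"
    have "ennreal (\<Sum>k\<in>F. diameter (U k) powr s) = (\<Sum>k\<in>F. ennreal (diameter (U k) powr s))"
      by (simp add: sum_ennreal)
    also have "\<dots> \<le> (\<Sum>k. ennreal (diameter (U k) powr s))"
      by (intro sum_le_suminf F) auto
    also have "\<dots> \<le> ennreal (\<gamma> / 2)" by (rule sumU)
    finally have 1: "(\<Sum>k\<in>F. diameter (U k) powr s) \<le> \<gamma> / 2" using \<gamma>0 by (simp add: ennreal_le_iff)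
    have "(\<Sum>k\<in>F. (1 / 2 :: real) ^ Suc k) \<le> (\<Sum>k. (1 / 2) ^ Suc k)"
      using sums_summable[OF power_half_series] by (intro sum_le_suminf F) auto
    also have "\<dots> = 1" using sums_unique[OF power_half_series] by simp
    finally have "\<gamma> / 2 * (\<Sum>k\<in>F. (1 / 2 :: real) ^ Suc k) \<le> \<gamma> / 2 * 1"
      using \<gamma>0 by (intro mult_left_mono) auto
    then show "(\<Sum>k\<in>F. d k powr s) \<le> \<gamma> * 1 powr s"
      using 1 unfolding ds sum.distrib sum_distrib_left[symmetric] by simp
  qed
  \<comment> \<open>The index \<open>n\<close> controls the radius in \<open>P\<close> and bounds
    the denominator from below in \<open>R\<close>: radii tend to 0, and infinitely many
    denominators occur.\<close>
  define P where "P n zr \<longleftrightarrow> light_on U d I s \<gamma> (fst zr) (snd zr) \<and> 0 < snd zr \<and> snd zr \<le> (1 / 4) ^ n \<and>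
    (\<forall>i. i \<notin> I \<longrightarrow> fst zr $ i = a $ i)" for n and zr :: "(real ^ 'n) \<times> real"
  define R where "R n zr zr' \<longleftrightarrow> cyl I (fst zr') (snd zr') \<subseteq> cyl I (fst zr) (snd zr) \<and>
    (\<exists>q p. q > n \<and> snd zr' \<le> \<eta> * real q powr (-\<tau>) \<and> (\<forall>i\<in>I. fst zr' $ i = real_of_int (p i) / real q))"
    for n :: nat and zr zr' :: "(real ^ 'n) \<times> real"
  have "\<exists>f. \<forall>n. P n (f n) \<and> R n (f n) (f (Suc n))"
  proof (rule dependent_nat_choice)
    show "\<exists>zr. P 0 zr" using light0 by (intro exI[of _ "(a, 1)"]) (simp add: P_def)
  next
    fix zr n assume Pn: "P n zr"
    then have "\<exists>z \<rho>. light_on U d I s \<gamma> z \<rho> \<and> 0 < \<rho> \<and> \<rho> \<le> snd zr / 4 \<and> cyl I z \<rho> \<subseteq> cyl I (fst zr) (snd zr) \<and>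
      (\<forall>i. i \<notin> I \<longrightarrow> z $ i = a $ i) \<and>
      (\<exists>q p. q > n \<and> \<rho> \<le> \<eta> * real q powr (-\<tau>) \<and> (\<forall>i\<in>I. z $ i = real_of_int (p i) / real q))"
      unfolding \<gamma>_def P_def using dU by (intro light_step I s tau stau \<eta> d0) auto
    then obtain z \<rho> where z: "light_on U d I s \<gamma> z \<rho>" "0 < \<rho>" "\<rho> \<le> snd zr / 4"
      "cyl I z \<rho> \<subseteq> cyl I (fst zr) (snd zr)" "\<forall>i. i \<notin> I \<longrightarrow> z $ i = a $ i"
      "\<exists>q p. q > n \<and> \<rho> \<le> \<eta> * real q powr (-\<tau>) \<and> (\<forall>i\<in>I. z $ i = real_of_int (p i) / real q)"
      by blast
    moreover have "\<rho> \<le> (1 / 4) ^ Suc n" using z(3) Pn by (simp add: P_def)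
    ultimately have "P (Suc n) (z, \<rho>)" "R n zr (z, \<rho>)" unfolding P_def R_def by auto
    then show "\<exists>zr'. P (Suc n) zr' \<and> R n zr zr'" by blast
  qed
  then obtain f where Pf: "\<And>n. P n (f n)" and Rf: "\<And>n. R n (f n) (f (Suc n))" by blast
  \<comment> \<open>A cylinder is unbounded in the directions outside \<open>I\<close>; fixing those
    coordinates leaves a compact box.\<close>
  define B where "B n = {x \<in> cyl I (fst (f n)) (snd (f n)). \<forall>i. i \<notin> I \<longrightarrow> x $ i = a $ i}" for n
  have "compact (B n)" for n
  proof -
    let ?z = "fst (f n)" and ?r = "snd (f n)"
    have 1: "\<bar>x $ i - ?z $ i\<bar> \<le> ?r \<longleftrightarrow> ?z $ i - ?r \<le> x $ i \<and> x $ i \<le> ?z $ i + ?r" for x :: "real ^ 'n" and i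
      by linarith
    have 2: "x $ i = a $ i \<longleftrightarrow> a $ i \<le> x $ i \<and> x $ i \<le> a $ i" for x :: "real ^ 'n" and i
      by linarith
    have "B n = cbox (\<chi> i. if i \<in> I then ?z $ i - ?r else a $ i) (\<chi> i. if i \<in> I then ?z $ i + ?r else a $ i)"
      unfolding B_def cyl_def set_eq_iff mem_box_cart mem_Collect_eq vec_lambda_beta 1 2 by auto
    then show ?thesis by simp
  qed
  moreover have "B n \<noteq> {}" for n
  proof -
    have "fst (f n) \<in> B n" using Pf[of n] by (simp add: B_def P_def cyl_def)
    then show ?thesis by blast
  qed
  moreover have "B n \<subseteq> B k" if "k \<le> n" for k n
    using _ that
  proof (rule lift_Suc_antimono_le)
    show "B (Suc n) \<subseteq> B n" for n using Rf[of n] unfolding B_def R_def by blast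
  qed
  ultimately have "\<Inter>(range B) \<noteq> {}" by (rule compact_nest)
  then obtain x where x: "\<And>n. x \<in> B n" by blast
  have "x \<in> E"
    unfolding E_def
  proof (intro CollectI conjI)
    show "\<forall>i. i \<notin> I \<longrightarrow> x $ i = a $ i" using x[of 0] by (simp add: B_def)
    show "infinite {q. q \<ge> 1 \<and> (\<exists>p. \<forall>i\<in>I. \<bar>x $ i - real_of_int (p i) / real q\<bar> \<le> \<eta> * real q powr (-\<tau>))}"
      unfolding infinite_nat_iff_unbounded
    proof
      fix n
      obtain q p where q: "q > n" "snd (f (Suc n)) \<le> \<eta> * real q powr (-\<tau>)"
        "\<forall>i\<in>I. fst (f (Suc n)) $ i = real_of_int (p i) / real q"
        using Rf[of n] unfolding R_def by blast
      have "\<bar>x $ i - real_of_int (p i) / real q\<bar> \<le> \<eta> * real q powr (-\<tau>)" if "i \<in> I" for i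
      proof -
        have "\<bar>x $ i - fst (f (Suc n)) $ i\<bar> \<le> snd (f (Suc n))"
          using x[of "Suc n"] that by (simp add: B_def cyl_def)
        then show ?thesis using q that by simp
      qed
      then show "\<exists>q>n. q \<in> {q. q \<ge> 1 \<and> (\<exists>p. \<forall>i\<in>I. \<bar>x $ i - real_of_int (p i) / real q\<bar> \<le> \<eta> * real q powr (-\<tau>))}"
        using q(1) by (intro exI[of _ q]) auto
    qed
  qed
  then obtain k where k: "x \<in> U k" using cov by blast
  \<comment> \<open>The member containing \<open>x\<close> meets every cylinder of the sequence, so
    lightness forces its size below every radius, although \<open>d k\<close> is positive.\<close>
  have "d k \<le> (1 / 4) ^ n" for n
  proof (rule ccontr)
    assume "\<not> d k \<le> (1 / 4) ^ n"
    then have "snd (f n) < d k" using Pf[of n] by (simp add: P_def)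
    then have "snd (f n) powr s < d k powr s" using Pf[of n] s by (intro powr_less_mono2) (auto simp: P_def)
    moreover have "(\<Sum>j\<in>{k}. d j powr s) \<le> \<gamma> * snd (f n) powr s"
    proof -
      have "x \<in> cyl I (fst (f n)) (snd (f n))" using x[of n] by (simp add: B_def)
      then have "\<forall>j\<in>{k}. U j \<inter> cyl I (fst (f n)) (snd (f n)) \<noteq> {}" using k by blast
      then show ?thesis using Pf[of n] unfolding P_def light_on_def by blast
    qed
    moreover have "\<gamma> * snd (f n) powr s \<le> 1 * snd (f n) powr s" using \<gamma>1 by (intro mult_right_mono) auto
    ultimately show False by simp
  qed
  moreover obtain n where "(1 / 4 :: real) ^ n < d k" using real_arch_pow_inv[OF d0, of "1/4" k] by auto
  ultimately show False by (meson not_le)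
qed

section \<open>Bounds for the dimension\<close>

lemma hausdorff_dim_le:
  assumes "s \<ge> 0" "\<And>t. t > s \<Longrightarrow> hausdorff_measure t A = 0"
  shows "hausdorff_dim A \<le> s"
proof (rule field_le_epsilon)
  fix e :: real assume "e > 0"
  then have "s + e \<in> {s. 0 < s \<and> hausdorff_measure s A = 0}" using assms by simp
  then show "hausdorff_dim A \<le> s + e"
    unfolding hausdorff_dim_def by (rule cInf_lower) (auto intro: bdd_belowI[of _ 0])
qed

text \<open>The witness \<open>t\<close> makes the set under the infimum nonempty, as
  \<open>cInf_greatest\<close> requires.\<close>

lemma hausdorff_dim_ge:
  assumes "t > 0" "hausdorff_measure t A = 0"
    and "\<And>t. 0 < t \<Longrightarrow> t < s \<Longrightarrow> hausdorff_measure t A \<noteq> 0"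
  shows "s \<le> hausdorff_dim A"
  unfolding hausdorff_dim_def using assms by (intro cInf_greatest) force+

lemma summable_restrict_iff_summable_on:
  fixes f :: "nat \<Rightarrow> real"
  assumes "\<And>q. f q \<ge> 0"
  shows "summable (\<lambda>q. if q \<in> Q then f q else 0) \<longleftrightarrow> f summable_on Q"
proof -
  have "f summable_on Q \<longleftrightarrow> (\<lambda>q. if q \<in> Q then f q else 0) summable_on UNIV"
    by (rule summable_on_cong_neutral) auto
  then show ?thesis using assms by (simp add: summable_on_UNIV_nonneg_real_iff)
qed

lemma conv_exponent_less_1D:
  assumes "conv_exponent Q < 1"
  obtains \<nu> where "\<nu> < 1" "summable (\<lambda>q. if q \<in> Q then real q powr (-\<nu>) else 0)"
proof -
  \<comment> \<open>Exponent 2 shows that the infimum is over a nonempty set, so that an infimum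
    below 1 yields an element below 1.\<close>
  have "summable (\<lambda>q. if q \<in> Q then real q powr (-2) else 0)"
    by (rule summable_comparison_test'[where g = "\<lambda>q. real q powr (-2)" and N = 0])
      (auto simp: summable_real_powr_iff)
  then have "2 \<in> {\<nu>. 0 < \<nu> \<and> (\<lambda>q. real q powr (-\<nu>)) summable_on Q}"
    by (simp add: summable_restrict_iff_summable_on)
  then have "{\<nu>. 0 < \<nu> \<and> (\<lambda>q. real q powr (-\<nu>)) summable_on Q} \<noteq> {}" by blast
  from cInf_lessD[OF this] assms obtain \<nu> where "\<nu> < 1" "(\<lambda>q. real q powr (-\<nu>)) summable_on Q"
    unfolding conv_exponent_def by blast
  then show ?thesis by (intro that) (simp_all add: summable_restrict_iff_summable_on)
qed

section \<open>Null and non-null exponents\<close>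

text \<open>\<open>W_star\<close> lies in the set with all denominators allowed, and the series of
  \<open>q powr (n - \<tau> * t)\<close> converges because its exponent is below -1.\<close>

lemma hausdorff_null_W_star:
  assumes "\<tau> > 0" "t > (real CARD('n) + 1) / \<tau>"
  shows "hausdorff_measure t (W_star \<tau> Q :: (real ^ 'n) set) = 0"
proof -
  have t: "t > 0" using assms by (smt (verit) divide_nonneg_pos of_nat_0_le_iff)
  have "real CARD('n) - \<tau> * t < -1" using assms by (simp add: field_simps)
  then have "summable (\<lambda>q. if q \<in> {q. q \<ge> 1} then real q powr (real CARD('n) - \<tau> * t) else 0)"
    by (intro summable_comparison_test'[where g = "\<lambda>q. real q powr (real CARD('n) - \<tau> * t)" and N = 0,
          OF summable_real_powr_iff[THEN iffD2]])
      auto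
  then have "hausdorff_measure t (W_set \<tau> {q. q \<ge> 1} :: (real ^ 'n) set) = 0"
    by (rule hausdorff_null_W_set[OF t _ assms(1)])
  then show ?thesis by (rule hausdorff_null_subset[OF t]) (auto simp: W_star_def)
qed

text \<open>No coordinate is frozen, and \<open>\<eta> = 1 / 2\<close> turns the weak inequality
  into the strict one.\<close>

lemma hausdorff_measure_W_set_neq_0:
  assumes tau: "\<tau> \<ge> 1 + 1 / real CARD('n)" and s: "s > 0" "s * \<tau> < real CARD('n) + 1"
  shows "hausdorff_measure s (W_set \<tau> {q. q \<ge> 1} :: (real ^ 'n) set) \<noteq> 0"
proof
  assume "hausdorff_measure s (W_set \<tau> {q. q \<ge> 1} :: (real ^ 'n) set) = 0"
  moreover have "{x :: real ^ 'n. (\<forall>i. i \<notin> UNIV \<longrightarrow> x $ i = 0 $ i) \<and>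
    infinite {q. q \<ge> 1 \<and> (\<exists>p. \<forall>i\<in>UNIV. \<bar>x $ i - real_of_int (p i) / real q\<bar> \<le> 1 / 2 * real q powr (-\<tau>))}}
    \<subseteq> W_set \<tau> {q. q \<ge> 1}"
  proof
    fix x :: "real ^ 'n" assume "x \<in> {x. (\<forall>i. i \<notin> UNIV \<longrightarrow> x $ i = 0 $ i) \<and>
      infinite {q. q \<ge> 1 \<and> (\<exists>p. \<forall>i\<in>UNIV. \<bar>x $ i - real_of_int (p i) / real q\<bar> \<le> 1 / 2 * real q powr (-\<tau>))}}"
    then have inf: "infinite {q. q \<ge> 1 \<and> (\<exists>p. \<forall>i. \<bar>x $ i - real_of_int (p i) / real q\<bar> \<le> 1 / 2 * real q powr (-\<tau>))}"
      by simp
    have "{q. q \<ge> 1 \<and> (\<exists>p. \<forall>i. \<bar>x $ i - real_of_int (p i) / real q\<bar> \<le> 1 / 2 * real q powr (-\<tau>))} \<subseteq>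
      {q \<in> {q. q \<ge> 1}. q \<ge> 1 \<and> (\<exists>p. \<forall>i. \<bar>x $ i - real_of_int (p i) / real q\<bar> < real q powr (-\<tau>))}"
    proof safe
      fix q p assume q: "1 \<le> q" and p: "\<forall>i. \<bar>x $ i - real_of_int (p i) / real q\<bar> \<le> 1 / 2 * real q powr (-\<tau>)"
      have "1 / 2 * real q powr (-\<tau>) < real q powr (-\<tau>)" using q by simp
      then have "\<forall>i. \<bar>x $ i - real_of_int (p i) / real q\<bar> < real q powr (-\<tau>)" using p le_less_trans by blast
      then show "\<exists>p. \<forall>i. \<bar>x $ i - real_of_int (p i) / real q\<bar> < real q powr (-\<tau>)" by blast
    qed
    then show "x \<in> W_set \<tau> {q. q \<ge> 1}" unfolding W_set_def using inf finite_subset by blast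
  qed
  ultimately have "hausdorff_measure s {x :: real ^ 'n. (\<forall>i. i \<notin> UNIV \<longrightarrow> x $ i = 0 $ i) \<and>
    infinite {q. q \<ge> 1 \<and> (\<exists>p. \<forall>i\<in>UNIV. \<bar>x $ i - real_of_int (p i) / real q\<bar> \<le> 1 / 2 * real q powr (-\<tau>))}} = 0"
    by (rule hausdorff_null_subset[OF s(1)])
  moreover have "hausdorff_measure s {x :: real ^ 'n. (\<forall>i. i \<notin> UNIV \<longrightarrow> x $ i = 0 $ i) \<and>
    infinite {q. q \<ge> 1 \<and> (\<exists>p. \<forall>i\<in>UNIV. \<bar>x $ i - real_of_int (p i) / real q\<bar> \<le> 1 / 2 * real q powr (-\<tau>))}} \<noteq> 0"
    by (rule hausdorff_measure_well_approximable_neq_0) (use assms in auto)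
  ultimately show False by blast
qed

text \<open>If some coordinate of \<open>x\<close> equals \<open>1 / v\<close> with \<open>v \<notin> Q\<close>, then every sufficiently large
  denominator of an approximation of \<open>x\<close> is a multiple of \<open>v\<close> and hence lies outside \<open>Q\<close>. The other
  \<open>n - 1\<close> coordinates remain free.\<close>

lemma notin_W_set_of_coordinate:
  fixes x :: "real ^ 'n"
  assumes free: "nfree Q" and v: "v \<ge> 1" "v \<notin> Q" and xj: "x $ j = 1 / real v" and tau: "\<tau> > 1"
  shows "x \<notin> W_set \<tau> Q"
proof -
  \<comment> \<open>If \<open>v\<close> does not divide \<open>q\<close>, the nonzero number
    \<open>1 / v - p j / q\<close> is at least \<open>1 / (v * q)\<close> in absolute value.
    Compared with the error \<open>q powr -\<tau>\<close> this gives
    \<open>q powr (\<tau> - 1) < v\<close>, hence \<open>q \<le> M\<close>.\<close>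
  define M where "M = nat \<lceil>real v powr (1 / (\<tau> - 1))\<rceil>"
  have "{q \<in> Q. q \<ge> 1 \<and> (\<exists>p :: 'n \<Rightarrow> int. \<forall>i. \<bar>x $ i - real_of_int (p i) / real q\<bar> < real q powr (-\<tau>))} \<subseteq> {..M}"
  proof safe
    fix q and p :: "'n \<Rightarrow> int"
    assume q: "q \<in> Q" "q \<ge> 1" and p: "\<forall>i. \<bar>x $ i - real_of_int (p i) / real q\<bar> < real q powr (-\<tau>)"
    have "\<not> v dvd q" using free q v unfolding nfree_def by blast
    then have "int q \<noteq> int v * p j" by (metis dvd_triv_left int_dvd_int_iff)
    then have "1 \<le> \<bar>int q - int v * p j\<bar>" by linarith
    then have "1 \<le> real_of_int \<bar>int q - int v * p j\<bar>" by (metis of_int_1_le_iff)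
    then have 1: "1 \<le> \<bar>real q - real v * real_of_int (p j)\<bar>" by simp
    have "1 / real v - real_of_int (p j) / real q = (real q - real v * real_of_int (p j)) / (real v * real q)"
      using q v by (simp add: field_simps)
    then have "\<bar>real q - real v * real_of_int (p j)\<bar> / (real v * real q) < real q powr (-\<tau>)"
      using p[rule_format, of j] xj by (simp add: abs_mult)
    then have "1 / (real v * real q) < real q powr (-\<tau>)"
      using 1 by (smt (verit) divide_right_mono mult_nonneg_nonneg of_nat_0_le_iff)
    then have "1 < real v * real q * real q powr (-\<tau>)" using q v by (simp add: field_simps)
    also have "\<dots> = real v * real q powr (1 - \<tau>)" using q by (simp add: powr_diff powr_minus field_simps)
    finally have "1 * real q powr (\<tau> - 1) < (real v * real q powr (1 - \<tau>)) * real q powr (\<tau> - 1)"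
      using q by (intro mult_strict_right_mono) auto
    also have "\<dots> = real v" using q by (simp add: mult.assoc powr_add[symmetric])
    finally have "(real q powr (\<tau> - 1)) powr (1 / (\<tau> - 1)) \<le> real v powr (1 / (\<tau> - 1))"
      using tau by (intro powr_mono2) auto
    then have "real q \<le> real v powr (1 / (\<tau> - 1))" using tau q by (simp add: powr_powr)
    also have "\<dots> \<le> real M" unfolding M_def by linarith
    finally show "q \<le> M" by simp
  qed
  then show ?thesis unfolding W_set_def using finite_subset by blast
qed

lemma hausdorff_measure_W_star_neq_0:
  assumes free: "nfree Q" and v: "v \<ge> 1" "v \<notin> Q" and card: "CARD('n) \<ge> 2"
    and tau: "\<tau> \<ge> 1 + 1 / (real CARD('n) - 1)" "\<tau> > 1" and s: "s > 0" "s * \<tau> < real CARD('n)"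
  shows "hausdorff_measure s (W_star \<tau> Q :: (real ^ 'n) set) \<noteq> 0"
proof
  assume null: "hausdorff_measure s (W_star \<tau> Q :: (real ^ 'n) set) = 0"
  \<comment> \<open>Any coordinate may be frozen.\<close>
  define j :: 'n where "j = undefined"
  define I where "I = UNIV - {j}"
  define a :: "real ^ 'n" where "a = (\<chi> i. 1 / real v)"
  \<comment> \<open>The approximations used have denominator \<open>v * q\<close>, and
    \<open>\<eta> * q powr -\<tau>\<close> is half of \<open>(v * q) powr -\<tau>\<close>.\<close>
  define \<eta> where "\<eta> = 1 / 2 * real v powr (-\<tau>)"
  define E where "E = {x. (\<forall>i. i \<notin> I \<longrightarrow> x $ i = a $ i) \<and>
    infinite {q. q \<ge> 1 \<and> (\<exists>p. \<forall>i\<in>I. \<bar>x $ i - real_of_int (p i) / real q\<bar> \<le> \<eta> * real q powr (-\<tau>))}}"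
  have cI: "real (card I) = real CARD('n) - 1" using card by (simp add: I_def card_Diff_singleton of_nat_diff)
  then have "I \<noteq> {}" using card by auto
  have "real v powr (-\<tau>) \<le> 1" using v tau powr_mono[of "-\<tau>" 0 "real v"] by simp
  then have \<eta>: "0 < \<eta>" "\<eta> \<le> 1" using v by (simp_all add: \<eta>_def)
  have "hausdorff_measure s E \<noteq> 0"
    unfolding E_def using s tau cI \<open>I \<noteq> {}\<close> \<eta> by (intro hausdorff_measure_well_approximable_neq_0) auto
  moreover have "E \<subseteq> W_star \<tau> Q"
  proof
    fix x assume x: "x \<in> E"
    then have xj: "x $ j = 1 / real v" by (simp add: E_def I_def a_def)
    have "x \<notin> W_set \<tau> Q" by (rule notin_W_set_of_coordinate[OF free v xj tau(2)])
    moreover have "x \<in> W_set \<tau> {q. q \<ge> 1}"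
    proof -
      define A where "A = {q. q \<ge> 1 \<and> (\<exists>p. \<forall>i\<in>I. \<bar>x $ i - real_of_int (p i) / real q\<bar> \<le> \<eta> * real q powr (-\<tau>))}"
      have "infinite A" using x by (simp add: E_def A_def)
      then have "infinite ((*) v ` A)" using v by (simp add: finite_image_iff inj_on_def)
      moreover have "(*) v ` A \<subseteq> {q \<in> {q. q \<ge> 1}. q \<ge> 1 \<and>
        (\<exists>p. \<forall>i. \<bar>x $ i - real_of_int (p i) / real q\<bar> < real q powr (-\<tau>))}"
      proof
        fix q' assume "q' \<in> (*) v ` A"
        then obtain q p where q: "q' = v * q" "q \<ge> 1"
          and p: "\<And>i. i \<in> I \<Longrightarrow> \<bar>x $ i - real_of_int (p i) / real q\<bar> \<le> \<eta> * real q powr (-\<tau>)"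
          unfolding A_def by blast
        \<comment> \<open>Over the denominator \<open>v * q\<close> the coordinate \<open>j\<close>
          is met exactly, since \<open>q / (v * q) = 1 / v\<close>; the other fractions are merely
          expanded by \<open>v\<close>.\<close>
        define p' where "p' i = (if i = j then int q else int v * p i)" for i
        have q'1: "q' \<ge> 1" using q v by simp
        have "\<bar>x $ i - real_of_int (p' i) / real q'\<bar> < real q' powr (-\<tau>)" for i
        proof (cases "i = j")
          case True
          then have "real_of_int (p' i) / real q' = x $ i" using q v xj by (simp add: p'_def)
          then show ?thesis using q'1 by simp
        next
          case False
          then have "real_of_int (p' i) / real q' = real_of_int (p i) / real q"
            using q v by (simp add: p'_def)
          then have "\<bar>x $ i - real_of_int (p' i) / real q'\<bar> \<le> \<eta> * real q powr (-\<tau>)"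
            using p[of i] False by (simp add: I_def)
          also have "\<dots> = 1 / 2 * real q' powr (-\<tau>)" by (simp add: \<eta>_def q powr_mult)
          also have "\<dots> < real q' powr (-\<tau>)" using q'1 by simp
          finally show ?thesis .
        qed
        then show "q' \<in> {q \<in> {q. q \<ge> 1}. q \<ge> 1 \<and>
          (\<exists>p. \<forall>i. \<bar>x $ i - real_of_int (p i) / real q\<bar> < real q powr (-\<tau>))}"
          using q'1 by blast
      qed
      ultimately show ?thesis unfolding W_set_def using finite_subset by blast
    qed
    ultimately show "x \<in> W_star \<tau> Q" by (simp add: W_star_def)
  qed
  ultimately show False using hausdorff_null_subset[OF s(1) null] by blast
qed

theorem theorem1:
  fixes Q :: "nat set" and \<tau> :: real
  assumes Qpos: "0 \<notin> Q"
    and Qinf: "infinite Q"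
    and Qfree: "nfree Q"
    and Qproper: "\<exists>q\<ge>1. q \<notin> Q"
    and tau: "\<tau> > 1"
  shows "(conv_exponent Q < 1 \<and> \<tau> > 1 + 1 / real CARD('n) \<longrightarrow>
            hausdorff_dim (W_star \<tau> Q :: (real ^ 'n) set) = (real CARD('n) + 1) / \<tau>)
       \<and> (conv_exponent Q = 1 \<and> CARD('n) \<ge> 2 \<and> \<tau> > 1 + 1 / (real CARD('n) - 1) \<longrightarrow>
            real CARD('n) / \<tau> \<le> hausdorff_dim (W_star \<tau> Q :: (real ^ 'n) set) \<and>
            hausdorff_dim (W_star \<tau> Q :: (real ^ 'n) set) \<le> (real CARD('n) + 1) / \<tau>)"
proof -
  let ?W = "W_star \<tau> Q :: (real ^ 'n) set" and ?n = "real CARD('n)"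
  have null: "hausdorff_measure t ?W = 0" if "t > (?n + 1) / \<tau>" for t
    using tau that by (intro hausdorff_null_W_star) auto
  have upper: "hausdorff_dim ?W \<le> (?n + 1) / \<tau>"
    using tau by (intro hausdorff_dim_le null) auto
  \<comment> \<open>A null exponent, so that \<open>hausdorff_dim_ge\<close> can be applied.\<close>
  have t1: "(?n + 1) / \<tau> + 1 > 0" "hausdorff_measure ((?n + 1) / \<tau> + 1) ?W = 0"
    using tau by (auto intro!: null add_nonneg_pos)
  have "(?n + 1) / \<tau> \<le> hausdorff_dim ?W" if \<nu>: "conv_exponent Q < 1" and tau': "\<tau> > 1 + 1 / ?n"
  proof (rule hausdorff_dim_ge[OF t1])
    fix s assume s: "0 < s" "s < (?n + 1) / \<tau>"
    obtain \<nu> where \<nu>: "\<nu> < 1" "summable (\<lambda>q. if q \<in> Q then real q powr (-\<nu>) else 0)"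
      using conv_exponent_less_1D[OF \<nu>] .
    \<comment> \<open>Raising \<open>s\<close> to \<open>t\<close> keeps it below
      \<open>(n + 1) / \<tau>\<close> and makes \<open>W_set \<tau> Q\<close> null; a set that is
      not null for \<open>t\<close> is not null for \<open>s \<le> t\<close> either.\<close>
    define t where "t = max s ((?n + \<nu>) / \<tau>)"
    have t: "t > 0" "s \<le> t" using s by (auto simp: t_def)
    have "(?n + \<nu>) / \<tau> < (?n + 1) / \<tau>" using \<nu> tau by (intro divide_strict_right_mono) auto
    then have "t < (?n + 1) / \<tau>" using s by (simp add: t_def)
    then have t\<tau>: "t * \<tau> < ?n + 1" using tau by (simp add: pos_less_divide_eq)
    have "(?n + \<nu>) / \<tau> \<le> t" by (simp add: t_def)
    then have "?n - \<tau> * t \<le> -\<nu>" using tau by (simp add: pos_divide_le_eq algebra_simps)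
    then have "summable (\<lambda>q. if q \<in> Q then real q powr (?n - \<tau> * t) else 0)"
      using Qpos by (intro summable_comparison_test'[OF \<nu>(2), of 1]) (auto intro!: powr_mono)
    then have "hausdorff_measure t (W_set \<tau> Q :: (real ^ 'n) set) = 0"
      using tau by (intro hausdorff_null_W_set t) auto
    moreover have "hausdorff_measure t (W_set \<tau> {q. q \<ge> 1} :: (real ^ 'n) set) \<noteq> 0"
      using tau' t\<tau> t by (intro hausdorff_measure_W_set_neq_0) auto
    moreover have "W_set \<tau> {q. q \<ge> 1} \<subseteq> ?W \<union> W_set \<tau> Q" by (auto simp: W_star_def)
    ultimately have "hausdorff_measure t ?W \<noteq> 0"
      using hausdorff_null_Un[OF t(1), of ?W "W_set \<tau> Q"] hausdorff_null_subset[OF t(1)] by metis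
    then show "hausdorff_measure s ?W \<noteq> 0" using hausdorff_null_mono_exponent[OF s(1) t(2)] by metis
  qed
  moreover have "?n / \<tau> \<le> hausdorff_dim ?W" if "CARD('n) \<ge> 2" and "\<tau> > 1 + 1 / (?n - 1)"
  proof (rule hausdorff_dim_ge[OF t1])
    fix s assume "0 < s" "s < ?n / \<tau>"
    moreover obtain v where "v \<ge> 1" "v \<notin> Q" using Qproper by blast
    ultimately show "hausdorff_measure s ?W \<noteq> 0"
      using that tau by (intro hausdorff_measure_W_star_neq_0[OF Qfree, of v]) (auto simp: pos_less_divide_eq)
  qed
  ultimately show ?thesis using upper by (auto intro: order.antisym)
qed

end
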